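(* Let $\mathbb{K}$ be a field of characteristic $0$, let $\lambda\in\mathbb{K}$ be nonzero and let $X$ be a nonempty set. Let $\overline{\mathcal{M}(X)}$ be the monoid of bracketed words on $X$, with its bracket operation $\lfloor\ \rfloor$ extended linearly to $\mathbb{K}[\overline{\mathcal{M}(X)}]$, the free vector space on $\overline{\mathcal{M}(X)}$ made into an associative algebra by extending the concatenation product. Let $I$ be the smallest operated ideal of $\mathbb{K}[\overline{\mathcal{M}(X)}]$ (i.e. the smallest ideal closed under $\lfloor\ \rfloor$) containing all the elements $$\lfloor x\rfloor\lfloor y\rfloor-\lfloor\lfloor x\rfloor y\rfloor,\qquad \lfloor x\rfloor\lfloor y\rfloor-\lfloor x\lfloor y\rfloor\rfloor,\qquad \lfloor x\rfloor\lfloor y\rfloor-\lambda\lfloor xy\rfloor\qquad (x,y\in\overline{\mathcal{M}(X)}).$$ Put $\mathcal{A}(X)=\mathbb{K}[\overline{\mathcal{M}(X)}]/I$, let $\mathcal{P}:\mathcal{A}(X)\to\mathcal{A}(X)$ be the linear map induced by $\lfloor\ \rfloor$, and let $i:X\hookrightarrow\mathcal{A}(X)$ be the composite of the inclusions $X\subset\overline{\mathcal{M}(X)}\subset\mathbb{K}[\overline{\mathcal{M}(X)}]$ with the quotient map $\mathbb{K}[\overline{\mathcal{M}(X)}]\to\mathcal{A}(X)$. Then $(\mathcal{A}(X),\mathcal{P})$, with the inclusion $i$, is a free averaging algebra of weight $\lambda$ over the set $X$. That is, $(\mathcal{A}(X),\mathcal{P})$ is an averaging algebra of weight $\lambda$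 and, for any averaging algebra $(A,P)$ of weight $\lambda$ and any set map $f:X\to A$, there exists a unique morphism of averaging algebras $\widetilde f:(\mathcal{A}(X),\mathcal{P})\to(A,P)$ such that $\widetilde f\circ i=f$.
   Context: An averaging operator of weight $\lambda\neq0$ on an associative algebra $A$ is a linear map $P:A\to A$ with $P(a)P(b)=P(P(a)b)=P(aP(b))=\lambda P(ab)$ for all $a,b\in A$. The pair $(A,P)$ is called an averaging algebra of weight $\lambda$. A morphism $(A,P)\to(A',P')$ of averaging algebras of weight $\lambda$ is an algebra homomorphism $\varphi:A\to A'$ with $P'\circ\varphi=\varphi\circ P$. Bracketed words. For a set $S$, $\mathcal{M}(S)$ is the free monoid on $S$, and $\lfloor S\rfloor=\{\lfloor s\rfloor: s\in S\}$ is a copy of $S$; $\sqcup$ denotes disjoint union. Put $\mathcal{M}_0(X)=\mathcal{M}(X)$ and $\mathcal{M}_n(X)=\mathcal{M}(X\sqcup\lfloor\mathcal{M}_{n-1}(X)\rfloor)$ for $n\ge1$, with embeddings $\mathcal{M}_{n-1}(X)\hookrightarrow\mathcal{M}_n(X)$ induced inductively by $X\sqcup\lfloor\mathcal{M}_{n-2}(X)\rfloor\hookrightarrow X\sqcup\lfloor\mathcal{M}_{n-1}(X)\rfloor$ (and, for $n=1$, by $X\hookrightarrow X\sqcup\lfloor\mathcal{M}_0(X)\rfloor$). Then $\overline{\mathcal{M}(X)}=\bigcup_{n\ge0}\mathcal{M}_n(X)$ is the direct limit of these monoids, and $\lfloor\ \rfloor:\overline{\mathcal{M}(X)}\to\overline{\mathcal{M}(X)}$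 is the map $x\mapsto\lfloor x\rfloor$. *)

theory Defs
  imports "HOL-Algebra.Module" "HOL-Algebra.QuotRing"
begin

section \<open>Associative algebras and averaging algebras\<close>

text \<open>
  The library locale \<open>algebra\<close> is commutative, hence the following one.  Algebras are unital,
  and (through \<open>ring_hom\<close>) algebra homomorphisms preserve the unit: the free algebra on a set is
  built from the free monoid, whose empty word is the unit.
\<close>

locale assoc_algebra = module R M + ring M for R (structure) and M (structure) +
  assumes smult_mult_l: "\<lbrakk>c \<in> carrier R; x \<in> carrier M; y \<in> carrier M\<rbrakk> \<Longrightarrow>
      (c \<odot>\<^bsub>M\<^esub> x) \<otimes>\<^bsub>M\<^esub> y = c \<odot>\<^bsub>M\<^esub> (x \<otimes>\<^bsub>M\<^esub> y)"
    and smult_mult_r: "\<lbrakk>c \<in> carrier R; x \<in> carrier M; y \<in> carrier M\<rbrakk> \<Longrightarrow>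
      x \<otimes>\<^bsub>M\<^esub> (c \<odot>\<^bsub>M\<^esub> y) = c \<odot>\<^bsub>M\<^esub> (x \<otimes>\<^bsub>M\<^esub> y)"

definition linear_maps ::
  "('k, 'n) ring_scheme \<Rightarrow> ('k, 'a, 'm) module_scheme \<Rightarrow> ('k, 'b, 'p) module_scheme \<Rightarrow> ('a \<Rightarrow> 'b) set"
  where "linear_maps K A B = {h. h \<in> carrier A \<rightarrow> carrier B \<and>
    (\<forall>x\<in>carrier A. \<forall>y\<in>carrier A. h (x \<oplus>\<^bsub>A\<^esub> y) = h x \<oplus>\<^bsub>B\<^esub> h y) \<and>
    (\<forall>c\<in>carrier K. \<forall>x\<in>carrier A. h (c \<odot>\<^bsub>A\<^esub> x) = c \<odot>\<^bsub>B\<^esub> h x)}"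

locale averaging_algebra = assoc_algebra K A for K (structure) and A (structure) +
  fixes wt :: 'a and P :: "'c \<Rightarrow> 'c"
  assumes wt_closed: "wt \<in> carrier K"
    and wt_nonzero: "wt \<noteq> \<zero>\<^bsub>K\<^esub>"
    and P_linear: "P \<in> linear_maps K A A"
    and P_mult_left: "\<lbrakk>a \<in> carrier A; b \<in> carrier A\<rbrakk> \<Longrightarrow> P a \<otimes>\<^bsub>A\<^esub> P b = P (P a \<otimes>\<^bsub>A\<^esub> b)"
    and P_mult_right: "\<lbrakk>a \<in> carrier A; b \<in> carrier A\<rbrakk> \<Longrightarrow> P a \<otimes>\<^bsub>A\<^esub> P b = P (a \<otimes>\<^bsub>A\<^esub> P b)"
    and P_mult_wt: "\<lbrakk>a \<in> carrier A; b \<in> carrier A\<rbrakk> \<Longrightarrow> P a \<otimes>\<^bsub>A\<^esub> P b = wt \<odot>\<^bsub>A\<^esub> P (a \<otimes>\<^bsub>A\<^esub> b)"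

definition averaging_hom ::
  "('k, 'n) ring_scheme \<Rightarrow> ('k, 'a, 'm) module_scheme \<Rightarrow> ('a \<Rightarrow> 'a) \<Rightarrow>
    ('k, 'b, 'p) module_scheme \<Rightarrow> ('b \<Rightarrow> 'b) \<Rightarrow> ('a \<Rightarrow> 'b) set"
  where "averaging_hom K A P B Q =
    {h \<in> ring_hom A B \<inter> linear_maps K A B. \<forall>x\<in>carrier A. Q (h x) = h (P x)}"


section \<open>Bracketed words\<close>

text \<open>
  Words are lists of letters, a letter being a variable or a bracketed word.  All the free monoids
  \<open>bwords n S\<close> live in one type, so that the embeddings of the \<open>n\<close>-th into the \<open>n+1\<close>-st are
  inclusions and the direct limit is the union.
\<close>

datatype 'x letter = Var 'x | Br "'x letter list"

type_synonym 'x bword = "'x letter list"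

primrec bwords :: "nat \<Rightarrow> 'x set \<Rightarrow> 'x bword set" where
  "bwords 0 S = lists (Var ` S)"
| "bwords (Suc n) S = lists (Var ` S \<union> Br ` bwords n S)"

definition bword_monoid :: "'x set \<Rightarrow> 'x bword monoid"
  where "bword_monoid S = \<lparr>carrier = (\<Union>n. bwords n S), mult = (@), one = []\<rparr>"

definition bracket :: "'x bword \<Rightarrow> 'x bword"
  where "bracket w = [Br w]"


section \<open>Monoid algebras\<close>

definition basis_elem :: "('k, 'n) ring_scheme \<Rightarrow> 'w \<Rightarrow> 'w \<Rightarrow> 'k"
  where "basis_elem K w = (\<lambda>u. if u = w then \<one>\<^bsub>K\<^esub> else \<zero>\<^bsub>K\<^esub>)"

text \<open>
  The free vector space on the carrier of \<open>M\<close>, as finitely supported functions, with the bilinear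
  extension of the product of \<open>M\<close>.
\<close>

definition monoid_algebra ::
  "('k, 'n) ring_scheme \<Rightarrow> ('w, 'm) monoid_scheme \<Rightarrow> ('k, 'w \<Rightarrow> 'k) module"
  where "monoid_algebra K M =
    \<lparr>carrier = {f. (\<forall>w. f w \<in> carrier K) \<and> {w. f w \<noteq> \<zero>\<^bsub>K\<^esub>} \<subseteq> carrier M \<and>
                  finite {w. f w \<noteq> \<zero>\<^bsub>K\<^esub>}},
     mult = (\<lambda>f g w. \<Oplus>\<^bsub>K\<^esub>p \<in> {(u, v). f u \<noteq> \<zero>\<^bsub>K\<^esub> \<and> g v \<noteq> \<zero>\<^bsub>K\<^esub> \<and> u \<otimes>\<^bsub>M\<^esub> v = w}.
                  f (fst p) \<otimes>\<^bsub>K\<^esub> g (snd p)),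
     one = basis_elem K \<one>\<^bsub>M\<^esub>,
     zero = (\<lambda>w. \<zero>\<^bsub>K\<^esub>),
     add = (\<lambda>f g w. f w \<oplus>\<^bsub>K\<^esub> g w),
     smult = (\<lambda>c f w. c \<otimes>\<^bsub>K\<^esub> f w)\<rparr>"

definition linear_extension ::
  "('k, 'n) ring_scheme \<Rightarrow> ('w \<Rightarrow> 'v) \<Rightarrow> ('w \<Rightarrow> 'k) \<Rightarrow> ('v \<Rightarrow> 'k)"
  where "linear_extension K \<phi> f = (\<lambda>v. \<Oplus>\<^bsub>K\<^esub>u \<in> {u. f u \<noteq> \<zero>\<^bsub>K\<^esub> \<and> \<phi> u = v}. f u)"


section \<open>Operated ideals and quotients\<close>

definition operated_ideal :: "'a set \<Rightarrow> ('a, 'm) ring_scheme \<Rightarrow> ('a \<Rightarrow> 'a) \<Rightarrow> bool"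
  where "operated_ideal I R N \<longleftrightarrow> ideal I R \<and> (\<forall>a\<in>I. N a \<in> I)"

definition gen_operated_ideal :: "('a, 'm) ring_scheme \<Rightarrow> ('a \<Rightarrow> 'a) \<Rightarrow> 'a set \<Rightarrow> 'a set"
  where "gen_operated_ideal R N S = \<Inter>{I. operated_ideal I R N \<and> S \<subseteq> I}"

text \<open>
  The map induced on cosets, in the style of \<open>rcoset_mult\<close>.  If \<open>h\<close> does not respect the cosets of
  \<open>I\<close>, the union is not a coset; so once \<open>induced_map A I h\<close> maps the carrier of the quotient
  into itself, it satisfies \<open>induced_map A I h (I +> a) = I +> h a\<close>.
\<close>

definition induced_map :: "('a, 'm) ring_scheme \<Rightarrow> 'a set \<Rightarrow> ('a \<Rightarrow> 'a) \<Rightarrow> 'a set \<Rightarrow> 'a set"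
  where "induced_map A I h C = (\<Union>a\<in>C. I +>\<^bsub>A\<^esub> h a)"

definition quotient_algebra :: "('k, 'a, 'm) module_scheme \<Rightarrow> 'a set \<Rightarrow> ('k, 'a set) module"
  where "quotient_algebra A I =
    ring.extend (A Quot I) (module.fields (\<lambda>c. induced_map A I (\<lambda>a. c \<odot>\<^bsub>A\<^esub> a)))"


section \<open>The algebra \<open>\<A>(S)\<close>\<close>

abbreviation bword_algebra :: "('k, 'n) ring_scheme \<Rightarrow> 'x set \<Rightarrow> ('k, 'x bword \<Rightarrow> 'k) module"
  where "bword_algebra K S \<equiv> monoid_algebra K (bword_monoid S)"

definition averaging_relators ::
  "('k, 'n) ring_scheme \<Rightarrow> 'k \<Rightarrow> 'x set \<Rightarrow> ('x bword \<Rightarrow> 'k) set"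
  where "averaging_relators K wt S =
    (let A = bword_algebra K S; M = bword_monoid S; e = basis_elem K in
     \<Union>x\<in>carrier M. \<Union>y\<in>carrier M.
      {e (bracket x \<otimes>\<^bsub>M\<^esub> bracket y) \<ominus>\<^bsub>A\<^esub> e (bracket (bracket x \<otimes>\<^bsub>M\<^esub> y)),
       e (bracket x \<otimes>\<^bsub>M\<^esub> bracket y) \<ominus>\<^bsub>A\<^esub> e (bracket (x \<otimes>\<^bsub>M\<^esub> bracket y)),
       e (bracket x \<otimes>\<^bsub>M\<^esub> bracket y) \<ominus>\<^bsub>A\<^esub> wt \<odot>\<^bsub>A\<^esub> e (bracket (x \<otimes>\<^bsub>M\<^esub> y))})"

definition averaging_ideal :: "('k, 'n) ring_scheme \<Rightarrow> 'k \<Rightarrow> 'x set \<Rightarrow> ('x bword \<Rightarrow> 'k) set"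
  where "averaging_ideal K wt S =
    gen_operated_ideal (bword_algebra K S) (linear_extension K bracket) (averaging_relators K wt S)"

definition free_averaging ::
  "('k, 'n) ring_scheme \<Rightarrow> 'k \<Rightarrow> 'x set \<Rightarrow> ('k, ('x bword \<Rightarrow> 'k) set) module"
  where "free_averaging K wt S = quotient_algebra (bword_algebra K S) (averaging_ideal K wt S)"

definition free_averaging_op ::
  "('k, 'n) ring_scheme \<Rightarrow> 'k \<Rightarrow> 'x set \<Rightarrow> ('x bword \<Rightarrow> 'k) set \<Rightarrow> ('x bword \<Rightarrow> 'k) set"
  where "free_averaging_op K wt S =
    induced_map (bword_algebra K S) (averaging_ideal K wt S) (linear_extension K bracket)"

definition free_averaging_incl ::
  "('k, 'n) ring_scheme \<Rightarrow> 'k \<Rightarrow> 'x set \<Rightarrow> 'x \<Rightarrow> ('x bword \<Rightarrow> 'k) set"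
  where "free_averaging_incl K wt S x =
    averaging_ideal K wt S +>\<^bsub>bword_algebra K S\<^esub> basis_elem K [Var x]"

end

theory Submission
  imports Defs
begin

text \<open>
  All identities in play are linear or bilinear, so they need only be checked on the (images of the)
  bracketed words, which span.  The averaging identities thus hold in the quotient because the
  relators are in the ideal.  A map \<open>f\<close> on variables extends to words by evaluation, reading the
  bracket as \<open>P\<close>, and then linearly; the kernel of this extension is an operated ideal containing
  the relators, so the extension factors through the quotient.
\<close>

section \<open>Linear maps and spans\<close>

text \<open>No normal form of words modulo the ideal is computed. Equalities in the quotient need
  only the relators and a spanning set. The single claim that elements of the quotient differ,
  injectivity of the inclusion, is obtained by mapping to a concrete averaging algebra. The obstacle
  in the monoid algebra is bookkeeping: products and linear extensions are sums over index sets that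
  depend on supports, and supports shrink under cancellation. Each such sum is therefore rewritten
  over a fixed finite superset with a conditional summand, after which sums for different arguments
  are compared term by term. All laws hold on carriers only, so closure facts accompany every
  identity, and uniqueness of a map is meant among functions that are \<open>extensional\<close> on
  the carrier.\<close>

lemma (in abelian_group) minus_eq_zero_iff:
  assumes "a \<in> carrier G" "b \<in> carrier G"
  shows "a \<ominus> b = \<zero> \<longleftrightarrow> a = b"
proof
  assume "a \<ominus> b = \<zero>"
  then show "a = b" using assms a_inv_closed minus_minus minus_equality[of a "\<ominus> b"]
    by (simp add: a_minus_def)
qed (use assms in \<open>simp add: a_minus_def r_neg\<close>)

lemma linear_mapsI:
  assumes "\<And>x. x \<in> carrier A \<Longrightarrow> h x \<in> carrier B"
    and "\<And>x y. x \<in> carrier A \<Longrightarrow> y \<in> carrier A \<Longrightarrow> h (x \<oplus>\<^bsub>A\<^esub> y) = h x \<oplus>\<^bsub>B\<^esub> h y"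
    and "\<And>c x. c \<in> carrier K \<Longrightarrow> x \<in> carrier A \<Longrightarrow> h (c \<odot>\<^bsub>A\<^esub> x) = c \<odot>\<^bsub>B\<^esub> h x"
  shows "h \<in> linear_maps K A B"
  using assms by (auto simp: linear_maps_def)

lemma linear_maps_closed: "h \<in> linear_maps K A B \<Longrightarrow> x \<in> carrier A \<Longrightarrow> h x \<in> carrier B"
  by (auto simp: linear_maps_def)

lemma linear_maps_add:
  "h \<in> linear_maps K A B \<Longrightarrow> x \<in> carrier A \<Longrightarrow> y \<in> carrier A \<Longrightarrow> h (x \<oplus>\<^bsub>A\<^esub> y) = h x \<oplus>\<^bsub>B\<^esub> h y"
  by (auto simp: linear_maps_def)

lemma linear_maps_smult:
  "h \<in> linear_maps K A B \<Longrightarrow> c \<in> carrier K \<Longrightarrow> x \<in> carrier A \<Longrightarrow> h (c \<odot>\<^bsub>A\<^esub> x) = c \<odot>\<^bsub>B\<^esub> h x"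
  by (auto simp: linear_maps_def)

lemma linear_maps_comp:
  assumes "h \<in> linear_maps K A B" "h' \<in> linear_maps K B C"
  shows "(\<lambda>x. h' (h x)) \<in> linear_maps K A C"
  using assms by (auto simp: linear_maps_def Pi_iff)

lemma linear_maps_id: "(\<lambda>x. x) \<in> linear_maps K A A"
  by (auto simp: linear_maps_def)

lemma linear_maps_zero:
  assumes "module K A" "module K B" "h \<in> linear_maps K A B"
  shows "h \<zero>\<^bsub>A\<^esub> = \<zero>\<^bsub>B\<^esub>"
proof -
  interpret A: module K A by fact
  interpret B: module K B by fact
  have "h \<zero>\<^bsub>A\<^esub> = h (\<zero>\<^bsub>K\<^esub> \<odot>\<^bsub>A\<^esub> \<zero>\<^bsub>A\<^esub>)" by simp
  also have "\<dots> = \<zero>\<^bsub>K\<^esub> \<odot>\<^bsub>B\<^esub> h \<zero>\<^bsub>A\<^esub>" by (rule linear_maps_smult[OF assms(3)]) auto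
  also have "\<dots> = \<zero>\<^bsub>B\<^esub>" using linear_maps_closed[OF assms(3)] by simp
  finally show ?thesis .
qed

lemma linear_maps_minus:
  assumes "module K A" "module K B" "h \<in> linear_maps K A B" "x \<in> carrier A" "y \<in> carrier A"
  shows "h (x \<ominus>\<^bsub>A\<^esub> y) = h x \<ominus>\<^bsub>B\<^esub> h y"
proof -
  interpret A: module K A by fact
  interpret B: module K B by fact
  note cl = linear_maps_closed[OF assms(3)]
  have "h (\<ominus>\<^bsub>A\<^esub> y) \<oplus>\<^bsub>B\<^esub> h y = h (\<ominus>\<^bsub>A\<^esub> y \<oplus>\<^bsub>A\<^esub> y)"
    using assms by (simp add: linear_maps_add)
  also have "\<dots> = \<zero>\<^bsub>B\<^esub>" using assms by (simp add: A.M.l_neg linear_maps_zero)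
  finally have "h (\<ominus>\<^bsub>A\<^esub> y) = \<ominus>\<^bsub>B\<^esub> h y"
    using assms cl by (intro B.M.minus_equality[symmetric]) auto
  then show ?thesis
    using assms by (simp add: a_minus_def linear_maps_add)
qed

text \<open>Scalars multiply generators only; every linear combination is still reached, as a sum of
  such terms. The induction rule then asks exactly for what a linear map preserves: zero, scaled
  generators, sums.\<close>

inductive_set lspan ::
  "('k, 'n) ring_scheme \<Rightarrow> ('k, 'a, 'm) module_scheme \<Rightarrow> 'a set \<Rightarrow> 'a set"
  for K and A and B where
  zero: "\<zero>\<^bsub>A\<^esub> \<in> lspan K A B"
| smult: "c \<in> carrier K \<Longrightarrow> b \<in> B \<Longrightarrow> c \<odot>\<^bsub>A\<^esub> b \<in> lspan K A B"
| add: "x \<in> lspan K A B \<Longrightarrow> y \<in> lspan K A B \<Longrightarrow> x \<oplus>\<^bsub>A\<^esub> y \<in> lspan K A B"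

lemma lspan_closed:
  assumes "module K A" "B \<subseteq> carrier A" "x \<in> lspan K A B"
  shows "x \<in> carrier A"
proof -
  interpret A: module K A by fact
  show ?thesis using assms(3,2) by (induction rule: lspan.induct) auto
qed

lemma lspan_image:
  assumes "module K A" "module K C" "h \<in> linear_maps K A C" "B \<subseteq> carrier A" "x \<in> lspan K A B"
  shows "h x \<in> lspan K C (h ` B)"
  using assms(5)
proof (induction rule: lspan.induct)
  case zero
  then show ?case using assms by (simp add: linear_maps_zero lspan.zero)
next
  case (smult c b)
  then have "h (c \<odot>\<^bsub>A\<^esub> b) = c \<odot>\<^bsub>C\<^esub> h b" using assms(4) by (auto intro: linear_maps_smult[OF assms(3)])
  then show ?case using smult by (simp add: lspan.smult)
next
  case (add x y)
  then show ?case using assms lspan_closed[OF assms(1,4)]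
    by (simp add: linear_maps_add lspan.add)
qed

lemma linear_maps_eq_on_lspan:
  assumes "module K A" "module K C" "h \<in> linear_maps K A C" "h' \<in> linear_maps K A C"
    and "B \<subseteq> carrier A" "x \<in> lspan K A B" "\<And>b. b \<in> B \<Longrightarrow> h b = h' b"
  shows "h x = h' x"
  using assms(6)
proof (induction rule: lspan.induct)
  case zero
  then show ?case using assms by (simp add: linear_maps_zero)
next
  case (smult c b)
  then have "b \<in> carrier A" using assms(5) by auto
  then show ?case
    using smult assms(7) linear_maps_smult[OF assms(3)] linear_maps_smult[OF assms(4)] by simp
next
  case (add x y)
  then show ?case using assms lspan_closed[OF assms(1,5)] by (simp add: linear_maps_add)
qed

text \<open>Linearity is used twice: with a generator in the first slot the second argument is
  freed, and then, with the second argument fixed, the first. Associativity, multiplicativity of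
  lifts and the averaging identities are all reduced to generators this way.\<close>

lemma bilinear_eq_on_lspan:
  assumes A: "module K A" "module K C" and B: "B \<subseteq> carrier A" "carrier A \<subseteq> lspan K A B"
    and F: "\<And>y. y \<in> carrier A \<Longrightarrow> (\<lambda>x. F x y) \<in> linear_maps K A C"
      "\<And>x. x \<in> carrier A \<Longrightarrow> F x \<in> linear_maps K A C"
    and G: "\<And>y. y \<in> carrier A \<Longrightarrow> (\<lambda>x. G x y) \<in> linear_maps K A C"
      "\<And>x. x \<in> carrier A \<Longrightarrow> G x \<in> linear_maps K A C"
    and eq: "\<And>b b'. b \<in> B \<Longrightarrow> b' \<in> B \<Longrightarrow> F b b' = G b b'"
    and xy: "x \<in> carrier A" "y \<in> carrier A"
  shows "F x y = G x y"
proof -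
  have "F b y = G b y" if "b \<in> B" for b
    by (rule linear_maps_eq_on_lspan[OF A F(2) G(2) B(1)]) (use that B xy eq in auto)
  then show ?thesis
    using linear_maps_eq_on_lspan[OF A F(1)[OF xy(2)] G(1)[OF xy(2)] B(1)] B(2) xy(1) by blast
qed

context assoc_algebra
begin

lemma l_mult_linear: "x \<in> carrier M \<Longrightarrow> (\<lambda>y. x \<otimes>\<^bsub>M\<^esub> y) \<in> linear_maps R M M"
  by (rule linear_mapsI) (auto simp: r_distr smult_mult_r)

lemma r_mult_linear: "y \<in> carrier M \<Longrightarrow> (\<lambda>x. x \<otimes>\<^bsub>M\<^esub> y) \<in> linear_maps R M M"
  by (rule linear_mapsI) (auto simp: l_distr smult_mult_l)

text \<open>Scaling by \<open>c\<close> commutes with scaling by any other scalar because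
  \<open>R\<close> is commutative.\<close>

lemma smult_linear: "c \<in> carrier R \<Longrightarrow> (\<lambda>x. c \<odot>\<^bsub>M\<^esub> x) \<in> linear_maps R M M"
  by (rule linear_mapsI) (simp_all add: smult_r_distr smult_assoc1[symmetric], simp add: R.m_comm)

end

section \<open>Monoid algebras\<close>

locale monoid_algebra_loc = K: cring K + M: monoid M
  for K :: "('k, 'n) ring_scheme" and M :: "('w, 'm) monoid_scheme"
begin

abbreviation KM where "KM \<equiv> monoid_algebra K M"
abbreviation e where "e \<equiv> basis_elem K"
abbreviation supp where "supp f \<equiv> {w. f w \<noteq> \<zero>\<^bsub>K\<^esub>}"

lemma algebra_carrier_iff:
  "f \<in> carrier KM \<longleftrightarrow> (\<forall>w. f w \<in> carrier K) \<and> supp f \<subseteq> carrier M \<and> finite (supp f)"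
  by (simp add: monoid_algebra_def)

lemma algebra_add: "f \<oplus>\<^bsub>KM\<^esub> g = (\<lambda>w. f w \<oplus>\<^bsub>K\<^esub> g w)"
  and algebra_smult: "c \<odot>\<^bsub>KM\<^esub> f = (\<lambda>w. c \<otimes>\<^bsub>K\<^esub> f w)"
  and algebra_zero: "\<zero>\<^bsub>KM\<^esub> = (\<lambda>w. \<zero>\<^bsub>K\<^esub>)"
  and algebra_one: "\<one>\<^bsub>KM\<^esub> = e \<one>\<^bsub>M\<^esub>"
  by (simp_all add: monoid_algebra_def)

lemma algebra_coeff: "f \<in> carrier KM \<Longrightarrow> f w \<in> carrier K"
  by (simp add: algebra_carrier_iff)

text \<open>Any finite set outside which the function vanishes will do, so the exact support of a
  sum or product, which cancellation may shrink, never has to be determined.\<close>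

lemma algebra_carrierI:
  assumes "finite T" "T \<subseteq> carrier M" "\<And>w. f w \<in> carrier K" "\<And>w. w \<notin> T \<Longrightarrow> f w = \<zero>\<^bsub>K\<^esub>"
  shows "f \<in> carrier KM"
proof -
  have "supp f \<subseteq> T" using assms by auto
  then show ?thesis using assms finite_subset[of "supp f" T] by (auto simp: algebra_carrier_iff)
qed

lemma basis_closed: "w \<in> carrier M \<Longrightarrow> e w \<in> carrier KM"
  by (rule algebra_carrierI[of "{w}"]) (auto simp: basis_elem_def)

lemma algebra_add_closed:
  assumes "f \<in> carrier KM" "g \<in> carrier KM" shows "f \<oplus>\<^bsub>KM\<^esub> g \<in> carrier KM"
  unfolding algebra_add
  by (rule algebra_carrierI[of "supp f \<union> supp g"]) (use assms in \<open>auto simp: algebra_carrier_iff\<close>)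

lemma algebra_smult_closed:
  assumes "c \<in> carrier K" "f \<in> carrier KM" shows "c \<odot>\<^bsub>KM\<^esub> f \<in> carrier KM"
  unfolding algebra_smult
  by (rule algebra_carrierI[of "supp f"]) (use assms in \<open>auto simp: algebra_carrier_iff\<close>)

lemma algebra_module: "module K KM"
proof (rule moduleI)
  show "abelian_group KM"
  proof (rule abelian_groupI)
    fix f assume f: "f \<in> carrier KM"
    have "(\<lambda>w. \<ominus>\<^bsub>K\<^esub> f w) \<in> carrier KM"
      by (rule algebra_carrierI[of "supp f"]) (use f in \<open>auto simp: algebra_carrier_iff\<close>)
    then show "\<exists>g\<in>carrier KM. g \<oplus>\<^bsub>KM\<^esub> f = \<zero>\<^bsub>KM\<^esub>"
      by (rule bexI[rotated])
        (use f in \<open>auto simp: algebra_add algebra_zero K.l_neg algebra_coeff\<close>)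
  next
    show "\<zero>\<^bsub>KM\<^esub> \<in> carrier KM"
      by (rule algebra_carrierI[of "{}"]) (auto simp: algebra_zero)
  qed (auto simp: algebra_add_closed, auto simp: algebra_add algebra_zero algebra_coeff
        K.a_ac)
qed (auto simp: algebra_smult_closed K.is_cring, auto simp: algebra_add algebra_smult algebra_coeff
      K.l_distr K.r_distr K.m_assoc)

text \<open>The induction runs over a finite set containing the support, not over the support
  itself, so that a point with zero coefficient may simply be dropped.\<close>

lemma algebra_spanned: "carrier KM \<subseteq> lspan K KM (e ` carrier M)"
proof
  fix f assume "f \<in> carrier KM"
  interpret KM: module K KM by (rule algebra_module)
  have "finite T \<Longrightarrow> f \<in> carrier KM \<Longrightarrow> supp f \<subseteq> T \<Longrightarrow> f \<in> lspan K KM (e ` carrier M)" for T f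
  proof (induction T arbitrary: f rule: finite_induct)
    case empty
    then have "f = \<zero>\<^bsub>KM\<^esub>" by (auto simp: algebra_zero)
    then show ?case by (simp add: lspan.zero)
  next
    case (insert w T)
    show ?case
    proof (cases "f w = \<zero>\<^bsub>K\<^esub>")
      case True
      then show ?thesis using insert by auto
    next
      case False
      then have w: "w \<in> carrier M" using insert by (auto simp: algebra_carrier_iff)
      have fw: "f(w := \<zero>\<^bsub>K\<^esub>) \<in> carrier KM"
        by (rule algebra_carrierI[of "supp f"])
          (use insert in \<open>auto simp: algebra_carrier_iff\<close>)
      \<comment> \<open>The term at \<open>w\<close> is split off; what remains is supported in
        \<open>T\<close>.\<close>
      have "f = f(w := \<zero>\<^bsub>K\<^esub>) \<oplus>\<^bsub>KM\<^esub> f w \<odot>\<^bsub>KM\<^esub> e w"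
        using insert.prems by (auto simp: algebra_add algebra_smult basis_elem_def algebra_coeff fun_eq_iff)
      moreover have "f(w := \<zero>\<^bsub>K\<^esub>) \<in> lspan K KM (e ` carrier M)"
        using insert by (intro insert.IH fw) auto
      ultimately show ?thesis
        using w insert.prems by (metis lspan.intros(2,3) algebra_coeff imageI)
    qed
  qed
  then show "f \<in> lspan K KM (e ` carrier M)"
    using \<open>f \<in> carrier KM\<close> by (auto simp: algebra_carrier_iff)
qed

text \<open>The rectangle \<open>T \<times> U\<close> replaces the index set of the definition,
  which varies with both factors and with \<open>w\<close>. The added terms vanish: either the
  product of the pair is not \<open>w\<close>, or one of the two coefficients is zero.\<close>

lemma algebra_mult_eq:
  assumes "finite T" "finite U" "supp f \<subseteq> T" "supp g \<subseteq> U" "\<And>u. f u \<in> carrier K" "\<And>u. g u \<in> carrier K"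
  shows "(f \<otimes>\<^bsub>KM\<^esub> g) w = (\<Oplus>\<^bsub>K\<^esub>p \<in> T \<times> U.
    if fst p \<otimes>\<^bsub>M\<^esub> snd p = w then f (fst p) \<otimes>\<^bsub>K\<^esub> g (snd p) else \<zero>\<^bsub>K\<^esub>)"
  unfolding monoid_algebra_def monoid.simps ring.simps
  by (rule K.add.finprod_mono_neutral_cong_left) (use assms in auto)

lemma basis_mult: "e u \<otimes>\<^bsub>KM\<^esub> e v = e (u \<otimes>\<^bsub>M\<^esub> v)"
proof
  fix w
  show "(e u \<otimes>\<^bsub>KM\<^esub> e v) w = e (u \<otimes>\<^bsub>M\<^esub> v) w"
    by (subst algebra_mult_eq[of "{u}" "{v}"]) (auto simp: basis_elem_def)
qed

lemma algebra_mult_closed: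
  assumes "f \<in> carrier KM" "g \<in> carrier KM" shows "f \<otimes>\<^bsub>KM\<^esub> g \<in> carrier KM"
proof -
  note eq = algebra_mult_eq[of "supp f" "supp g" f g]
  show ?thesis
  proof (rule algebra_carrierI)
    \<comment> \<open>A product is supported on the products of support elements.\<close>
    let ?T = "(\<lambda>p. fst p \<otimes>\<^bsub>M\<^esub> snd p) ` (supp f \<times> supp g)"
    show "finite ?T" "?T \<subseteq> carrier M" using assms by (auto simp: algebra_carrier_iff subset_iff)
    show "(f \<otimes>\<^bsub>KM\<^esub> g) w \<in> carrier K" for w
      by (subst eq) (use assms in \<open>auto simp: algebra_carrier_iff intro!: K.finsum_closed\<close>)
    show "(f \<otimes>\<^bsub>KM\<^esub> g) w = \<zero>\<^bsub>K\<^esub>" if w: "w \<notin> ?T" for w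
    proof -
      have "fst p \<otimes>\<^bsub>M\<^esub> snd p \<noteq> w" if "p \<in> supp f \<times> supp g" for p
        using that w by blast
      then have "(\<Oplus>\<^bsub>K\<^esub>p \<in> supp f \<times> supp g. if fst p \<otimes>\<^bsub>M\<^esub> snd p = w
          then f (fst p) \<otimes>\<^bsub>K\<^esub> g (snd p) else \<zero>\<^bsub>K\<^esub>) = \<zero>\<^bsub>K\<^esub>"
        by (intro K.add.finprod_one_eqI) simp
      then show ?thesis
        using eq[of w] assms by (simp add: algebra_carrier_iff)
    qed
  qed
qed

lemma algebra_r_mult_linear:
  assumes g: "g \<in> carrier KM" shows "(\<lambda>f. f \<otimes>\<^bsub>KM\<^esub> g) \<in> linear_maps K KM KM"
proof (rule linear_mapsI)
  fix f f' assume f: "f \<in> carrier KM" "f' \<in> carrier KM"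
  let ?T = "supp f \<union> supp f'"
  show "(f \<oplus>\<^bsub>KM\<^esub> f') \<otimes>\<^bsub>KM\<^esub> g = f \<otimes>\<^bsub>KM\<^esub> g \<oplus>\<^bsub>KM\<^esub> f' \<otimes>\<^bsub>KM\<^esub> g"
  proof
    fix w
    \<comment> \<open>\<open>?T\<close> contains the supports of \<open>f\<close>, \<open>f'\<close>
      and their sum, so this one formula serves all three and distributivity in \<open>K\<close>
      applies to each summand.\<close>
    have eq: "(h \<otimes>\<^bsub>KM\<^esub> g) w = (\<Oplus>\<^bsub>K\<^esub>p \<in> ?T \<times> supp g. (if fst p \<otimes>\<^bsub>M\<^esub> snd p = w then h (fst p) \<otimes>\<^bsub>K\<^esub> g (snd p) else \<zero>\<^bsub>K\<^esub>))"
      if "h \<in> carrier KM" "supp h \<subseteq> ?T" for h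
      by (rule algebra_mult_eq) (use that f g in \<open>auto simp: algebra_carrier_iff\<close>)
    have "supp (f \<oplus>\<^bsub>KM\<^esub> f') \<subseteq> ?T"
      by (auto simp: algebra_add)
    then have "((f \<oplus>\<^bsub>KM\<^esub> f') \<otimes>\<^bsub>KM\<^esub> g) w = (\<Oplus>\<^bsub>K\<^esub>p \<in> ?T \<times> supp g. (if fst p \<otimes>\<^bsub>M\<^esub> snd p = w then (f \<oplus>\<^bsub>KM\<^esub> f') (fst p) \<otimes>\<^bsub>K\<^esub> g (snd p) else \<zero>\<^bsub>K\<^esub>))"
      by (intro eq algebra_add_closed f)
    also have "\<dots> = (\<Oplus>\<^bsub>K\<^esub>p \<in> ?T \<times> supp g.
        (if fst p \<otimes>\<^bsub>M\<^esub> snd p = w then f (fst p) \<otimes>\<^bsub>K\<^esub> g (snd p) else \<zero>\<^bsub>K\<^esub>) \<oplus>\<^bsub>K\<^esub>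
        (if fst p \<otimes>\<^bsub>M\<^esub> snd p = w then f' (fst p) \<otimes>\<^bsub>K\<^esub> g (snd p) else \<zero>\<^bsub>K\<^esub>))"
      by (rule K.finsum_cong') (use f g in \<open>auto simp: algebra_coeff algebra_add K.l_distr\<close>)
    also have "\<dots> = (f \<otimes>\<^bsub>KM\<^esub> g) w \<oplus>\<^bsub>K\<^esub> (f' \<otimes>\<^bsub>KM\<^esub> g) w"
      by (subst (1 2) eq, (use f in auto)[4], subst K.finsum_addf)
        (use f g in \<open>auto simp: algebra_coeff\<close>)
    finally show "((f \<oplus>\<^bsub>KM\<^esub> f') \<otimes>\<^bsub>KM\<^esub> g) w = (f \<otimes>\<^bsub>KM\<^esub> g \<oplus>\<^bsub>KM\<^esub> f' \<otimes>\<^bsub>KM\<^esub> g) w"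
      by (simp add: algebra_add)
  qed
next
  fix c f assume f: "c \<in> carrier K" "f \<in> carrier KM"
  let ?T = "supp f"
  show "(c \<odot>\<^bsub>KM\<^esub> f) \<otimes>\<^bsub>KM\<^esub> g = c \<odot>\<^bsub>KM\<^esub> (f \<otimes>\<^bsub>KM\<^esub> g)"
  proof
    fix w
    have eq: "(h \<otimes>\<^bsub>KM\<^esub> g) w = (\<Oplus>\<^bsub>K\<^esub>p \<in> ?T \<times> supp g. (if fst p \<otimes>\<^bsub>M\<^esub> snd p = w then h (fst p) \<otimes>\<^bsub>K\<^esub> g (snd p) else \<zero>\<^bsub>K\<^esub>))"
      if "h \<in> carrier KM" "supp h \<subseteq> ?T" for h
      by (rule algebra_mult_eq) (use that f g in \<open>auto simp: algebra_carrier_iff\<close>)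
    have "supp (c \<odot>\<^bsub>KM\<^esub> f) \<subseteq> ?T"
      using f by (auto simp: algebra_smult)
    then have "((c \<odot>\<^bsub>KM\<^esub> f) \<otimes>\<^bsub>KM\<^esub> g) w = (\<Oplus>\<^bsub>K\<^esub>p \<in> ?T \<times> supp g. (if fst p \<otimes>\<^bsub>M\<^esub> snd p = w then (c \<odot>\<^bsub>KM\<^esub> f) (fst p) \<otimes>\<^bsub>K\<^esub> g (snd p) else \<zero>\<^bsub>K\<^esub>))"
      by (intro eq algebra_smult_closed f)
    also have "\<dots> = (\<Oplus>\<^bsub>K\<^esub>p \<in> ?T \<times> supp g. c \<otimes>\<^bsub>K\<^esub>
        (if fst p \<otimes>\<^bsub>M\<^esub> snd p = w then f (fst p) \<otimes>\<^bsub>K\<^esub> g (snd p) else \<zero>\<^bsub>K\<^esub>))"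
      by (rule K.finsum_cong') (use f g in \<open>auto simp: algebra_coeff algebra_smult K.m_assoc\<close>)
    also have "\<dots> = c \<otimes>\<^bsub>K\<^esub> (f \<otimes>\<^bsub>KM\<^esub> g) w"
      by (subst eq, (use f in auto)[2], subst K.finsum_rdistr)
        (use f g in \<open>auto simp: algebra_coeff algebra_carrier_iff\<close>)
    finally show "((c \<odot>\<^bsub>KM\<^esub> f) \<otimes>\<^bsub>KM\<^esub> g) w = (c \<odot>\<^bsub>KM\<^esub> (f \<otimes>\<^bsub>KM\<^esub> g)) w"
      by (simp add: algebra_smult)
  qed
qed (use g in \<open>auto simp: algebra_mult_closed\<close>)

text \<open>The monoid is not commutative, so linearity in the right factor is a separate
  computation on the mirrored rectangle.\<close>

lemma algebra_l_mult_linear: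
  assumes g: "g \<in> carrier KM" shows "(\<lambda>f. g \<otimes>\<^bsub>KM\<^esub> f) \<in> linear_maps K KM KM"
proof (rule linear_mapsI)
  fix f f' assume f: "f \<in> carrier KM" "f' \<in> carrier KM"
  let ?T = "supp f \<union> supp f'"
  show "g \<otimes>\<^bsub>KM\<^esub> (f \<oplus>\<^bsub>KM\<^esub> f') = g \<otimes>\<^bsub>KM\<^esub> f \<oplus>\<^bsub>KM\<^esub> g \<otimes>\<^bsub>KM\<^esub> f'"
  proof
    fix w
    have eq: "(g \<otimes>\<^bsub>KM\<^esub> h) w = (\<Oplus>\<^bsub>K\<^esub>p \<in> supp g \<times> ?T. (if fst p \<otimes>\<^bsub>M\<^esub> snd p = w then g (fst p) \<otimes>\<^bsub>K\<^esub> h (snd p) else \<zero>\<^bsub>K\<^esub>))"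
      if "h \<in> carrier KM" "supp h \<subseteq> ?T" for h
      by (rule algebra_mult_eq) (use that f g in \<open>auto simp: algebra_carrier_iff\<close>)
    have "supp (f \<oplus>\<^bsub>KM\<^esub> f') \<subseteq> ?T"
      by (auto simp: algebra_add)
    then have "(g \<otimes>\<^bsub>KM\<^esub> (f \<oplus>\<^bsub>KM\<^esub> f')) w = (\<Oplus>\<^bsub>K\<^esub>p \<in> supp g \<times> ?T. (if fst p \<otimes>\<^bsub>M\<^esub> snd p = w then g (fst p) \<otimes>\<^bsub>K\<^esub> (f \<oplus>\<^bsub>KM\<^esub> f') (snd p) else \<zero>\<^bsub>K\<^esub>))"
      by (intro eq algebra_add_closed f)
    also have "\<dots> = (\<Oplus>\<^bsub>K\<^esub>p \<in> supp g \<times> ?T.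
        (if fst p \<otimes>\<^bsub>M\<^esub> snd p = w then g (fst p) \<otimes>\<^bsub>K\<^esub> f (snd p) else \<zero>\<^bsub>K\<^esub>) \<oplus>\<^bsub>K\<^esub>
        (if fst p \<otimes>\<^bsub>M\<^esub> snd p = w then g (fst p) \<otimes>\<^bsub>K\<^esub> f' (snd p) else \<zero>\<^bsub>K\<^esub>))"
      by (rule K.finsum_cong') (use f g in \<open>auto simp: algebra_coeff algebra_add K.r_distr\<close>)
    also have "\<dots> = (g \<otimes>\<^bsub>KM\<^esub> f) w \<oplus>\<^bsub>K\<^esub> (g \<otimes>\<^bsub>KM\<^esub> f') w"
      by (subst (1 2) eq, (use f in auto)[4], subst K.finsum_addf)
        (use f g in \<open>auto simp: algebra_coeff\<close>)
    finally show "(g \<otimes>\<^bsub>KM\<^esub> (f \<oplus>\<^bsub>KM\<^esub> f')) w = (g \<otimes>\<^bsub>KM\<^esub> f \<oplus>\<^bsub>KM\<^esub> g \<otimes>\<^bsub>KM\<^esub> f') w"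
      by (simp add: algebra_add)
  qed
next
  fix c f assume f: "c \<in> carrier K" "f \<in> carrier KM"
  let ?T = "supp f"
  show "g \<otimes>\<^bsub>KM\<^esub> (c \<odot>\<^bsub>KM\<^esub> f) = c \<odot>\<^bsub>KM\<^esub> (g \<otimes>\<^bsub>KM\<^esub> f)"
  proof
    fix w
    have eq: "(g \<otimes>\<^bsub>KM\<^esub> h) w = (\<Oplus>\<^bsub>K\<^esub>p \<in> supp g \<times> ?T. (if fst p \<otimes>\<^bsub>M\<^esub> snd p = w then g (fst p) \<otimes>\<^bsub>K\<^esub> h (snd p) else \<zero>\<^bsub>K\<^esub>))"
      if "h \<in> carrier KM" "supp h \<subseteq> ?T" for h
      by (rule algebra_mult_eq) (use that f g in \<open>auto simp: algebra_carrier_iff\<close>)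
    have "supp (c \<odot>\<^bsub>KM\<^esub> f) \<subseteq> ?T"
      using f by (auto simp: algebra_smult)
    then have "(g \<otimes>\<^bsub>KM\<^esub> (c \<odot>\<^bsub>KM\<^esub> f)) w = (\<Oplus>\<^bsub>K\<^esub>p \<in> supp g \<times> ?T. (if fst p \<otimes>\<^bsub>M\<^esub> snd p = w then g (fst p) \<otimes>\<^bsub>K\<^esub> (c \<odot>\<^bsub>KM\<^esub> f) (snd p) else \<zero>\<^bsub>K\<^esub>))"
      by (intro eq algebra_smult_closed f)
    also have "\<dots> = (\<Oplus>\<^bsub>K\<^esub>p \<in> supp g \<times> ?T. c \<otimes>\<^bsub>K\<^esub>
        (if fst p \<otimes>\<^bsub>M\<^esub> snd p = w then g (fst p) \<otimes>\<^bsub>K\<^esub> f (snd p) else \<zero>\<^bsub>K\<^esub>))"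
      \<comment> \<open>Here the scalar has to pass the coefficient of \<open>g\<close>, which takes
        commutativity of \<open>K\<close>.\<close>
      by (rule K.finsum_cong') (use f g in \<open>auto simp: algebra_coeff algebra_smult K.m_lcomm\<close>)
    also have "\<dots> = c \<otimes>\<^bsub>K\<^esub> (g \<otimes>\<^bsub>KM\<^esub> f) w"
      by (subst eq, (use f in auto)[2], subst K.finsum_rdistr)
        (use f g in \<open>auto simp: algebra_coeff algebra_carrier_iff\<close>)
    finally show "(g \<otimes>\<^bsub>KM\<^esub> (c \<odot>\<^bsub>KM\<^esub> f)) w = (c \<odot>\<^bsub>KM\<^esub> (g \<otimes>\<^bsub>KM\<^esub> f)) w"
      by (simp add: algebra_smult)
  qed
qed (use g in \<open>auto simp: algebra_mult_closed\<close>)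

text \<open>Associativity is a trilinear identity: with a basis element in the first slot it is
  bilinear in the other two, and linearity in the first slot finishes. On basis elements it is
  associativity of \<open>M\<close>. The unit laws compare multiplication by one with the identity
  map, again on the basis.\<close>

lemma algebra_assoc_algebra: "assoc_algebra K KM"
proof -
  interpret KM: module K KM by (rule algebra_module)
  note lin = algebra_l_mult_linear algebra_r_mult_linear
  have B: "e ` carrier M \<subseteq> carrier KM" by (auto simp: basis_closed)
  have assoc_basis: "(e u \<otimes>\<^bsub>KM\<^esub> g) \<otimes>\<^bsub>KM\<^esub> h = e u \<otimes>\<^bsub>KM\<^esub> (g \<otimes>\<^bsub>KM\<^esub> h)"
    if "u \<in> carrier M" "g \<in> carrier KM" "h \<in> carrier KM" for u g h
    by (rule bilinear_eq_on_lspan[OF algebra_module algebra_module B algebra_spanned,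
          where F = "\<lambda>g h. (e u \<otimes>\<^bsub>KM\<^esub> g) \<otimes>\<^bsub>KM\<^esub> h"])
      (use that in \<open>auto simp: basis_mult M.m_assoc basis_closed algebra_mult_closed
        intro: lin linear_maps_comp[OF lin(1) lin(1)]
          linear_maps_comp[OF lin(1) lin(2)] linear_maps_comp[OF lin(2) lin(1)]\<close>)
  have assoc: "(f \<otimes>\<^bsub>KM\<^esub> g) \<otimes>\<^bsub>KM\<^esub> h = f \<otimes>\<^bsub>KM\<^esub> (g \<otimes>\<^bsub>KM\<^esub> h)"
    if "f \<in> carrier KM" "g \<in> carrier KM" "h \<in> carrier KM" for f g h
    by (rule linear_maps_eq_on_lspan[OF algebra_module algebra_module
          linear_maps_comp[OF lin(2) lin(2)] lin(2) B, of g h "g \<otimes>\<^bsub>KM\<^esub> h" f])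
      (use that assoc_basis algebra_spanned in \<open>auto simp: algebra_mult_closed\<close>)
  have one: "\<one>\<^bsub>KM\<^esub> \<in> carrier KM" by (simp add: algebra_one basis_closed)
  have l_one: "\<one>\<^bsub>KM\<^esub> \<otimes>\<^bsub>KM\<^esub> f = f" if "f \<in> carrier KM" for f
    by (rule linear_maps_eq_on_lspan[OF algebra_module algebra_module
          lin(1)[OF one] linear_maps_id B, of f])
      (use that algebra_spanned in \<open>auto simp: algebra_one basis_mult\<close>)
  have r_one: "f \<otimes>\<^bsub>KM\<^esub> \<one>\<^bsub>KM\<^esub> = f" if "f \<in> carrier KM" for f
    by (rule linear_maps_eq_on_lspan[OF algebra_module algebra_module
          lin(2)[OF one] linear_maps_id B, of f])
      (use that algebra_spanned in \<open>auto simp: algebra_one basis_mult\<close>)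
  have "monoid KM"
    by (rule monoidI) (auto simp: algebra_mult_closed one assoc l_one r_one)
  then have "ring KM"
    by (intro ringI KM.M.abelian_group_axioms)
      (auto simp: linear_maps_add[OF lin(1)] linear_maps_add[OF lin(2)])
  then show ?thesis
    by (intro assoc_algebra.intro algebra_module assoc_algebra_axioms.intro)
      (auto simp: linear_maps_smult[OF lin(1)] linear_maps_smult[OF lin(2)])
qed

end

section \<open>Linear extension of maps on the monoid, and the universal property of the free
  module\<close>

context monoid_algebra_loc
begin

text \<open>The fibre of \<open>\<phi>\<close> over \<open>v\<close> inside the support is traded
  for a fixed finite set with a conditional summand, as for products.\<close>

lemma linear_extension_eq:
  assumes "finite T" "supp f \<subseteq> T" "\<And>u. f u \<in> carrier K"
  shows "linear_extension K \<phi> f v = (\<Oplus>\<^bsub>K\<^esub>u\<in>T. if \<phi> u = v then f u else \<zero>\<^bsub>K\<^esub>)"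
  unfolding linear_extension_def
  by (rule K.add.finprod_mono_neutral_cong_left) (use assms in auto)

lemma linear_extension_basis: "linear_extension K \<phi> (e u) = e (\<phi> u)"
proof
  show "linear_extension K \<phi> (e u) v = e (\<phi> u) v" for v
    by (subst linear_extension_eq[of "{u}"]) (auto simp: basis_elem_def)
qed

lemma linear_extension_linear:
  assumes \<phi>: "\<phi> \<in> carrier M \<rightarrow> carrier M"
  shows "linear_extension K \<phi> \<in> linear_maps K KM KM"
proof (rule linear_mapsI)
  fix f assume f: "f \<in> carrier KM"
  have eq: "linear_extension K \<phi> f v = (\<Oplus>\<^bsub>K\<^esub>u\<in>supp f. if \<phi> u = v then f u else \<zero>\<^bsub>K\<^esub>)" for v
    by (rule linear_extension_eq) (use f in \<open>auto simp: algebra_carrier_iff\<close>)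
  show "linear_extension K \<phi> f \<in> carrier KM"
  proof (rule algebra_carrierI)
    show "finite (\<phi> ` supp f)" "\<phi> ` supp f \<subseteq> carrier M"
      using f \<phi> by (auto simp: algebra_carrier_iff)
    show "linear_extension K \<phi> f v \<in> carrier K" for v
      unfolding eq by (rule K.finsum_closed) (use f in \<open>auto simp: algebra_coeff\<close>)
    show "linear_extension K \<phi> f v = \<zero>\<^bsub>K\<^esub>" if "v \<notin> \<phi> ` supp f" for v
      unfolding eq by (rule K.add.finprod_one_eqI) (use that in auto)
  qed
next
  fix f f' assume f: "f \<in> carrier KM" "f' \<in> carrier KM"
  let ?T = "supp f \<union> supp f'"
  have eq: "linear_extension K \<phi> h v = (\<Oplus>\<^bsub>K\<^esub>u\<in>?T. if \<phi> u = v then h u else \<zero>\<^bsub>K\<^esub>)"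
    if "h \<in> carrier KM" "supp h \<subseteq> ?T" for h v
    by (rule linear_extension_eq) (use that f in \<open>auto simp: algebra_carrier_iff\<close>)
  show "linear_extension K \<phi> (f \<oplus>\<^bsub>KM\<^esub> f') = linear_extension K \<phi> f \<oplus>\<^bsub>KM\<^esub> linear_extension K \<phi> f'"
  proof
    fix v
    have "supp (f \<oplus>\<^bsub>KM\<^esub> f') \<subseteq> ?T" by (auto simp: algebra_add)
    then have "linear_extension K \<phi> (f \<oplus>\<^bsub>KM\<^esub> f') v =
        (\<Oplus>\<^bsub>K\<^esub>u\<in>?T. if \<phi> u = v then (f \<oplus>\<^bsub>KM\<^esub> f') u else \<zero>\<^bsub>K\<^esub>)"
      by (intro eq algebra_add_closed f)
    also have "\<dots> = (\<Oplus>\<^bsub>K\<^esub>u\<in>?T. (if \<phi> u = v then f u else \<zero>\<^bsub>K\<^esub>) \<oplus>\<^bsub>K\<^esub> (if \<phi> u = v then f' u else \<zero>\<^bsub>K\<^esub>))"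
      by (rule K.finsum_cong') (use f in \<open>auto simp: algebra_coeff algebra_add\<close>)
    also have "\<dots> = linear_extension K \<phi> f v \<oplus>\<^bsub>K\<^esub> linear_extension K \<phi> f' v"
      by (subst (1 2) eq, (use f in auto)[4], subst K.finsum_addf)
        (use f in \<open>auto simp: algebra_coeff\<close>)
    finally show "linear_extension K \<phi> (f \<oplus>\<^bsub>KM\<^esub> f') v =
        (linear_extension K \<phi> f \<oplus>\<^bsub>KM\<^esub> linear_extension K \<phi> f') v"
      by (simp add: algebra_add)
  qed
next
  fix c f assume f: "c \<in> carrier K" "f \<in> carrier KM"
  have eq: "linear_extension K \<phi> h v = (\<Oplus>\<^bsub>K\<^esub>u\<in>supp f. if \<phi> u = v then h u else \<zero>\<^bsub>K\<^esub>)"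
    if "h \<in> carrier KM" "supp h \<subseteq> supp f" for h v
    by (rule linear_extension_eq) (use that f in \<open>auto simp: algebra_carrier_iff\<close>)
  show "linear_extension K \<phi> (c \<odot>\<^bsub>KM\<^esub> f) = c \<odot>\<^bsub>KM\<^esub> linear_extension K \<phi> f"
  proof
    fix v
    have "supp (c \<odot>\<^bsub>KM\<^esub> f) \<subseteq> supp f" using f by (auto simp: algebra_smult)
    then have "linear_extension K \<phi> (c \<odot>\<^bsub>KM\<^esub> f) v =
        (\<Oplus>\<^bsub>K\<^esub>u\<in>supp f. if \<phi> u = v then (c \<odot>\<^bsub>KM\<^esub> f) u else \<zero>\<^bsub>K\<^esub>)"
      by (intro eq algebra_smult_closed f)
    also have "\<dots> = (\<Oplus>\<^bsub>K\<^esub>u\<in>supp f. c \<otimes>\<^bsub>K\<^esub> (if \<phi> u = v then f u else \<zero>\<^bsub>K\<^esub>))"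
      by (rule K.finsum_cong') (use f in \<open>auto simp: algebra_coeff algebra_smult\<close>)
    also have "\<dots> = c \<otimes>\<^bsub>K\<^esub> linear_extension K \<phi> f v"
      by (subst eq, (use f in auto)[2], subst K.finsum_rdistr)
        (use f in \<open>auto simp: algebra_coeff algebra_carrier_iff\<close>)
    finally show "linear_extension K \<phi> (c \<odot>\<^bsub>KM\<^esub> f) v = (c \<odot>\<^bsub>KM\<^esub> linear_extension K \<phi> f) v"
      by (simp add: algebra_smult)
  qed
qed

text \<open>The canonical map out of a free module. In contrast to \<open>linear_extension\<close>,
  the target is an arbitrary module and \<open>\<phi>\<close> takes values in it directly.\<close>

definition lift :: "('k, 'a, 'p) module_scheme \<Rightarrow> ('w \<Rightarrow> 'a) \<Rightarrow> ('w \<Rightarrow> 'k) \<Rightarrow> 'a"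
  where "lift V \<phi> f = (\<Oplus>\<^bsub>V\<^esub>u\<in>supp f. f u \<odot>\<^bsub>V\<^esub> \<phi> u)"

text \<open>The index set may be enlarged only within the monoid, because \<open>\<phi>\<close> is
  known to land in \<open>V\<close> only there.\<close>

lemma lift_eq:
  assumes "module K V" "\<phi> \<in> carrier M \<rightarrow> carrier V"
    and "finite T" "T \<subseteq> carrier M" "supp f \<subseteq> T" "f \<in> carrier KM"
  shows "lift V \<phi> f = (\<Oplus>\<^bsub>V\<^esub>u\<in>T. f u \<odot>\<^bsub>V\<^esub> \<phi> u)"
proof -
  interpret V: module K V by fact
  have \<phi>: "\<phi> u \<in> carrier V" if "u \<in> T" for u using assms that by auto
  show ?thesis unfolding lift_def
    by (rule V.M.add.finprod_mono_neutral_cong_left) (use assms \<phi> in \<open>auto simp: algebra_coeff\<close>)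
qed

lemma lift_linear:
  assumes V: "module K V" and \<phi>: "\<phi> \<in> carrier M \<rightarrow> carrier V"
  shows "lift V \<phi> \<in> linear_maps K KM V"
proof -
  interpret V: module K V by fact
  show ?thesis
  proof (rule linear_mapsI)
    fix f assume f: "f \<in> carrier KM"
    then have "\<phi> u \<in> carrier V" if "u \<in> supp f" for u
      using \<phi> that by (auto simp: algebra_carrier_iff)
    then show "lift V \<phi> f \<in> carrier V" unfolding lift_def
      by (intro V.M.finsum_closed) (use f in \<open>auto simp: algebra_coeff\<close>)
  next
    fix f f' assume f: "f \<in> carrier KM" "f' \<in> carrier KM"
    let ?T = "supp f \<union> supp f'"
    have T: "finite ?T" "?T \<subseteq> carrier M" using f by (auto simp: algebra_carrier_iff)
    have \<phi>T: "\<phi> u \<in> carrier V" if "u \<in> ?T" for u using \<phi> T that by blast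
    note eq = lift_eq[OF V \<phi> T]
    have "supp (f \<oplus>\<^bsub>KM\<^esub> f') \<subseteq> ?T" by (auto simp: algebra_add)
    then have "lift V \<phi> (f \<oplus>\<^bsub>KM\<^esub> f') = (\<Oplus>\<^bsub>V\<^esub>u\<in>?T. (f \<oplus>\<^bsub>KM\<^esub> f') u \<odot>\<^bsub>V\<^esub> \<phi> u)"
      by (intro eq algebra_add_closed f)
    also have "\<dots> = (\<Oplus>\<^bsub>V\<^esub>u\<in>?T. f u \<odot>\<^bsub>V\<^esub> \<phi> u \<oplus>\<^bsub>V\<^esub> f' u \<odot>\<^bsub>V\<^esub> \<phi> u)"
      by (rule V.M.finsum_cong')
        (use f \<phi>T in \<open>auto simp: algebra_coeff algebra_add V.smult_l_distr\<close>)
    also have "\<dots> = (\<Oplus>\<^bsub>V\<^esub>u\<in>?T. f u \<odot>\<^bsub>V\<^esub> \<phi> u) \<oplus>\<^bsub>V\<^esub> (\<Oplus>\<^bsub>V\<^esub>u\<in>?T. f' u \<odot>\<^bsub>V\<^esub> \<phi> u)"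
      by (rule V.M.finsum_addf) (use f \<phi>T in \<open>auto simp: algebra_coeff\<close>)
    also have "\<dots> = lift V \<phi> f \<oplus>\<^bsub>V\<^esub> lift V \<phi> f'"
      using f by (simp add: eq)
    finally show "lift V \<phi> (f \<oplus>\<^bsub>KM\<^esub> f') = lift V \<phi> f \<oplus>\<^bsub>V\<^esub> lift V \<phi> f'" .
  next
    fix c f assume f: "c \<in> carrier K" "f \<in> carrier KM"
    have T: "finite (supp f)" "supp f \<subseteq> carrier M" using f by (auto simp: algebra_carrier_iff)
    have \<phi>T: "\<phi> u \<in> carrier V" if "u \<in> supp f" for u using \<phi> T that by blast
    have "supp (c \<odot>\<^bsub>KM\<^esub> f) \<subseteq> supp f" using f by (auto simp: algebra_smult)
    then have "lift V \<phi> (c \<odot>\<^bsub>KM\<^esub> f) = (\<Oplus>\<^bsub>V\<^esub>u\<in>supp f. (c \<odot>\<^bsub>KM\<^esub> f) u \<odot>\<^bsub>V\<^esub> \<phi> u)"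
      by (intro lift_eq[OF V \<phi> T] algebra_smult_closed f)
    also have "\<dots> = (\<Oplus>\<^bsub>V\<^esub>u\<in>supp f. c \<odot>\<^bsub>V\<^esub> (f u \<odot>\<^bsub>V\<^esub> \<phi> u))"
      by (rule V.M.finsum_cong')
        (use f \<phi>T in \<open>auto simp: algebra_coeff algebra_smult V.smult_assoc1\<close>)
    also have "\<dots> = c \<odot>\<^bsub>V\<^esub> lift V \<phi> f"
      unfolding lift_def
      by (rule V.finsum_smult_ldistr[symmetric]) (use f \<phi>T T in \<open>auto simp: algebra_coeff\<close>)
    finally show "lift V \<phi> (c \<odot>\<^bsub>KM\<^esub> f) = c \<odot>\<^bsub>V\<^esub> lift V \<phi> f" .
  qed
qed

lemma lift_basis:
  assumes "module K V" "\<phi> \<in> carrier M \<rightarrow> carrier V" "w \<in> carrier M"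
  shows "lift V \<phi> (e w) = \<phi> w"
proof -
  interpret V: module K V by fact
  have "\<phi> w \<in> carrier V" using assms by auto
  \<comment> \<open>Only an inclusion: over the zero ring \<open>e w\<close> vanishes and its
    support is empty.\<close>
  moreover have "supp (e w) \<subseteq> {w}" by (auto simp: basis_elem_def)
  then have "lift V \<phi> (e w) = (\<Oplus>\<^bsub>V\<^esub>u\<in>{w}. e w u \<odot>\<^bsub>V\<^esub> \<phi> u)"
    by (intro lift_eq assms basis_closed) (use assms in auto)
  ultimately show ?thesis by (simp add: basis_elem_def)
qed

text \<open>Both sides of multiplicativity are bilinear in \<open>f\<close> and \<open>g\<close>,
  and on basis elements the identity is that of \<open>\<phi>\<close>. The unit is assumed
  separately because \<open>hom\<close> speaks of products only.\<close>

lemma lift_ring_hom: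
  assumes A: "assoc_algebra K A" and \<phi>: "\<phi> \<in> hom M A" "\<phi> \<one>\<^bsub>M\<^esub> = \<one>\<^bsub>A\<^esub>"
  shows "lift A \<phi> \<in> ring_hom KM A"
proof -
  interpret A: assoc_algebra K A by fact
  interpret KM: assoc_algebra K KM by (rule algebra_assoc_algebra)
  have \<phi>_cl: "\<phi> \<in> carrier M \<rightarrow> carrier A" using \<phi>(1) by (simp add: hom_def)
  note lin = lift_linear[OF A.module_axioms \<phi>_cl]
  note basis = lift_basis[OF A.module_axioms \<phi>_cl]
  note cl = linear_maps_closed[OF lin]
  have "lift A \<phi> (f \<otimes>\<^bsub>KM\<^esub> g) = lift A \<phi> f \<otimes>\<^bsub>A\<^esub> lift A \<phi> g"
    if "f \<in> carrier KM" "g \<in> carrier KM" for f g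
    by (rule bilinear_eq_on_lspan[OF algebra_module A.module_axioms _ algebra_spanned,
          where F = "\<lambda>f g. lift A \<phi> (f \<otimes>\<^bsub>KM\<^esub> g)"])
      (use that \<phi>(1) in \<open>auto simp: basis_closed cl basis_mult basis hom_mult
        intro!: linear_maps_comp[OF KM.l_mult_linear lin] linear_maps_comp[OF KM.r_mult_linear lin]
          linear_maps_comp[OF lin A.l_mult_linear] linear_maps_comp[OF lin A.r_mult_linear]\<close>)
  then show ?thesis
    by (intro ring_hom_memI) (auto simp: cl linear_maps_add[OF lin] algebra_one basis \<phi>(2))
qed

end

section \<open>Quotient algebras\<close>

locale algebra_ideal = A: assoc_algebra K A + ideal I A
  for K :: "('k, 'n) ring_scheme" and A :: "('k, 'a, 'm) module_scheme" and I
begin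

abbreviation Q where "Q \<equiv> quotient_algebra A I"
abbreviation proj where "proj a \<equiv> I +>\<^bsub>A\<^esub> a"

lemma proj_eq_iff:
  "a \<in> carrier A \<Longrightarrow> b \<in> carrier A \<Longrightarrow> proj a = proj b \<longleftrightarrow> a \<ominus>\<^bsub>A\<^esub> b \<in> I"
  using A.quotient_eq_iff_same_a_r_cos[OF ideal_axioms] by simp

lemma mem_proj_iff: "a \<in> carrier A \<Longrightarrow> b \<in> proj a \<longleftrightarrow> b \<in> carrier A \<and> proj b = proj a"
  using a_repr_independence' a_rcos_self A.a_r_coset_subset_G[OF a_subset] by blast

text \<open>An ideal of the underlying ring is already a subspace: scaling by \<open>c\<close> is
  multiplication by the ring element \<open>c \<odot> \<one>\<close>.\<close>

lemma smult_ideal: "c \<in> carrier K \<Longrightarrow> a \<in> I \<Longrightarrow> c \<odot>\<^bsub>A\<^esub> a \<in> I"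
  using A.smult_mult_l[of c "\<one>\<^bsub>A\<^esub>" a] I_l_closed[of a "c \<odot>\<^bsub>A\<^esub> \<one>\<^bsub>A\<^esub>"] by simp

text \<open>All members of a coset are sent by \<open>h\<close> into one and the same coset, so the
  union defining \<open>induced_map\<close> collapses to that coset. This serves both the scalar
  action and the operator of the quotient.\<close>

lemma induced_map_proj:
  assumes h: "h \<in> linear_maps K A A" "\<And>a. a \<in> I \<Longrightarrow> h a \<in> I" and a: "a \<in> carrier A"
  shows "induced_map A I h (proj a) = proj (h a)"
proof -
  have "proj (h b) = proj (h a)" if "b \<in> proj a" for b
  proof -
    have b: "b \<in> carrier A" "b \<ominus>\<^bsub>A\<^esub> a \<in> I" using that a by (auto simp: mem_proj_iff proj_eq_iff)
    then have "h b \<ominus>\<^bsub>A\<^esub> h a \<in> I"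
      using h a linear_maps_minus[OF A.module_axioms A.module_axioms h(1), of b a] by metis
    then show ?thesis using a b linear_maps_closed[OF h(1)] by (simp add: proj_eq_iff)
  qed
  moreover have "a \<in> proj a" using a by (rule a_rcos_self)
  ultimately show ?thesis unfolding induced_map_def by blast
qed

lemma quotient_carrier: "carrier Q = proj ` carrier A"
  and quotient_one: "\<one>\<^bsub>Q\<^esub> = proj \<one>\<^bsub>A\<^esub>"
  by (auto simp: quotient_algebra_def ring.defs FactRing_simps)

lemma quotient_zero: "\<zero>\<^bsub>Q\<^esub> = proj \<zero>\<^bsub>A\<^esub>"
  by (simp add: quotient_algebra_def ring.defs FactRing_def a_subset)

lemma quotient_add:
  "a \<in> carrier A \<Longrightarrow> b \<in> carrier A \<Longrightarrow> proj a \<oplus>\<^bsub>Q\<^esub> proj b = proj (a \<oplus>\<^bsub>A\<^esub> b)"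
  by (simp add: quotient_algebra_def ring.defs FactRing_def a_rcos_sum)

lemma quotient_mult:
  "a \<in> carrier A \<Longrightarrow> b \<in> carrier A \<Longrightarrow> proj a \<otimes>\<^bsub>Q\<^esub> proj b = proj (a \<otimes>\<^bsub>A\<^esub> b)"
  by (simp add: quotient_algebra_def ring.defs FactRing_def rcoset_mult_add)

lemma quotient_smult:
  "c \<in> carrier K \<Longrightarrow> a \<in> carrier A \<Longrightarrow> c \<odot>\<^bsub>Q\<^esub> proj a = proj (c \<odot>\<^bsub>A\<^esub> a)"
  by (simp add: quotient_algebra_def ring.defs module.defs induced_map_proj A.smult_linear smult_ideal)

lemmas quotient_simps =
  quotient_carrier quotient_one quotient_zero quotient_add quotient_mult quotient_smult

text \<open>Once elements are written as cosets of representatives, every law is the image under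
  \<open>proj\<close> of the same law in \<open>A\<close>.\<close>

lemma quotient_assoc_algebra: "assoc_algebra K Q"
proof -
  have grp: "abelian_group Q"
  proof (rule abelian_groupI)
    fix C assume "C \<in> carrier Q"
    then obtain a where "a \<in> carrier A" "C = proj a" by (auto simp: quotient_carrier)
    then show "\<exists>D\<in>carrier Q. D \<oplus>\<^bsub>Q\<^esub> C = \<zero>\<^bsub>Q\<^esub>"
      by (intro bexI[of _ "proj (\<ominus>\<^bsub>A\<^esub> a)"]) (auto simp: quotient_simps A.l_neg)
  qed (auto simp: quotient_simps A.a_ac)
  have "monoid Q"
    by (rule monoidI) (auto simp: quotient_simps A.m_assoc)
  then have "ring Q"
    by (intro ringI grp) (auto simp: quotient_simps A.l_distr A.r_distr)
  moreover have "module K Q"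
    by (rule moduleI[OF A.R.is_cring grp])
      (auto simp: quotient_simps A.smult_l_distr A.smult_r_distr A.smult_assoc1)
  ultimately show ?thesis
    by (intro assoc_algebra.intro assoc_algebra_axioms.intro)
      (auto simp: quotient_simps A.smult_mult_l A.smult_mult_r)
qed

lemma proj_linear: "proj \<in> linear_maps K A Q"
  by (rule linear_mapsI) (auto simp: quotient_simps)

lemma induced_map_linear:
  assumes h: "h \<in> linear_maps K A A" "\<And>a. a \<in> I \<Longrightarrow> h a \<in> I"
  shows "induced_map A I h \<in> linear_maps K Q Q"
  by (rule linear_mapsI)
    (auto simp: quotient_simps induced_map_proj[OF h] linear_maps_closed[OF h(1)]
      linear_maps_add[OF h(1)] linear_maps_smult[OF h(1)])

lemma quotient_spanned:
  assumes "B \<subseteq> carrier A" "carrier A \<subseteq> lspan K A B"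
  shows "carrier Q \<subseteq> lspan K Q (proj ` B)"
proof -
  interpret Q: assoc_algebra K Q by (rule quotient_assoc_algebra)
  show ?thesis
    using assms lspan_image[OF A.module_axioms Q.module_axioms proj_linear]
    by (auto simp: quotient_carrier)
qed

text \<open>The homomorphism theorem: \<open>h\<close> takes one value on each coset, since
  representatives differ by an element of \<open>I\<close>, which \<open>h\<close> kills.\<close>

lemma quotient_factor:
  assumes C: "assoc_algebra K C" and h: "h \<in> linear_maps K A C" "h \<in> ring_hom A C"
    and ker: "\<And>a. a \<in> I \<Longrightarrow> h a = \<zero>\<^bsub>C\<^esub>"
  obtains g where "g \<in> ring_hom Q C" "g \<in> linear_maps K Q C" "g \<in> extensional (carrier Q)"
    "\<And>a. a \<in> carrier A \<Longrightarrow> g (proj a) = h a"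
proof -
  interpret C: assoc_algebra K C by fact
  \<comment> \<open>The restriction fixes the values outside the carrier; without it the factor map
    could not be unique as a total function.\<close>
  define g where "g = restrict (\<lambda>D. h (SOME a. a \<in> D)) (carrier Q)"
  have g: "g (proj a) = h a" if a: "a \<in> carrier A" for a
  proof -
    define b where "b = (SOME b. b \<in> proj a)"
    have "b \<in> proj a" unfolding b_def by (rule someI) (rule a_rcos_self[OF a])
    then have b: "b \<in> carrier A" "b \<ominus>\<^bsub>A\<^esub> a \<in> I" using a by (auto simp: mem_proj_iff proj_eq_iff)
    then have "h b \<ominus>\<^bsub>C\<^esub> h a = \<zero>\<^bsub>C\<^esub>"
      using ker linear_maps_minus[OF A.module_axioms C.module_axioms h(1) b(1) a] by simp
    then have "h b = h a"
      using a b linear_maps_closed[OF h(1)] by (simp add: C.minus_eq_zero_iff)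
    then show ?thesis using a by (simp add: g_def quotient_carrier b_def[symmetric])
  qed
  show thesis
  proof (rule that)
    show "g \<in> ring_hom Q C"
      using ring_hom_closed[OF h(2)] ring_hom_mult[OF h(2)] ring_hom_add[OF h(2)] ring_hom_one[OF h(2)]
      by (intro ring_hom_memI) (auto simp: quotient_simps g)
    show "g \<in> linear_maps K Q C"
      by (rule linear_mapsI) (auto simp: quotient_simps g linear_maps_closed[OF h(1)]
          linear_maps_add[OF h(1)] linear_maps_smult[OF h(1)])
  qed (simp_all add: g, simp add: g_def)
qed

end

text \<open>Each side of the three identities is bilinear in the two arguments, being composed of
  \<open>P\<close>, one-sided multiplications and a scaling.\<close>

lemma averaging_algebraI_lspan:
  assumes "assoc_algebra K A" "wt \<in> carrier K" "wt \<noteq> \<zero>\<^bsub>K\<^esub>" and P: "P \<in> linear_maps K A A"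
    and B: "B \<subseteq> carrier A" "carrier A \<subseteq> lspan K A B"
    and rel: "\<And>a b. a \<in> B \<Longrightarrow> b \<in> B \<Longrightarrow> P a \<otimes>\<^bsub>A\<^esub> P b = P (P a \<otimes>\<^bsub>A\<^esub> b)"
      "\<And>a b. a \<in> B \<Longrightarrow> b \<in> B \<Longrightarrow> P a \<otimes>\<^bsub>A\<^esub> P b = P (a \<otimes>\<^bsub>A\<^esub> P b)"
      "\<And>a b. a \<in> B \<Longrightarrow> b \<in> B \<Longrightarrow> P a \<otimes>\<^bsub>A\<^esub> P b = wt \<odot>\<^bsub>A\<^esub> P (a \<otimes>\<^bsub>A\<^esub> b)"
  shows "averaging_algebra K A wt P"
proof -
  interpret A: assoc_algebra K A by fact
  note m = A.module_axioms
  note cl = linear_maps_closed[OF P]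
  note comp = linear_maps_comp[OF P]
  have PP: "(\<lambda>a. P a \<otimes>\<^bsub>A\<^esub> P b) \<in> linear_maps K A A" "(\<lambda>b. P a \<otimes>\<^bsub>A\<^esub> P b) \<in> linear_maps K A A"
    if "a \<in> carrier A" "b \<in> carrier A" for a b
    using that by (auto intro!: comp[OF A.l_mult_linear] comp[OF A.r_mult_linear] simp: cl)
  have 1: "P a \<otimes>\<^bsub>A\<^esub> P b = P (P a \<otimes>\<^bsub>A\<^esub> b)" if "a \<in> carrier A" "b \<in> carrier A" for a b
    by (rule bilinear_eq_on_lspan[OF m m B, where F = "\<lambda>a b. P a \<otimes>\<^bsub>A\<^esub> P b"])
      (use that rel(1) in \<open>auto simp: cl PP
        intro: linear_maps_comp[OF A.l_mult_linear P] comp[OF linear_maps_comp[OF A.r_mult_linear P]]\<close>)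
  have 2: "P a \<otimes>\<^bsub>A\<^esub> P b = P (a \<otimes>\<^bsub>A\<^esub> P b)" if "a \<in> carrier A" "b \<in> carrier A" for a b
    by (rule bilinear_eq_on_lspan[OF m m B, where F = "\<lambda>a b. P a \<otimes>\<^bsub>A\<^esub> P b"])
      (use that rel(2) in \<open>auto simp: cl PP
        intro: linear_maps_comp[OF A.r_mult_linear P] comp[OF linear_maps_comp[OF A.l_mult_linear P]]\<close>)
  have 3: "P a \<otimes>\<^bsub>A\<^esub> P b = wt \<odot>\<^bsub>A\<^esub> P (a \<otimes>\<^bsub>A\<^esub> b)" if "a \<in> carrier A" "b \<in> carrier A" for a b
    by (rule bilinear_eq_on_lspan[OF m m B, where F = "\<lambda>a b. P a \<otimes>\<^bsub>A\<^esub> P b"])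
      (use that rel(3) assms(2) in \<open>auto simp: cl PP
        intro: linear_maps_comp[OF linear_maps_comp[OF A.r_mult_linear P] A.smult_linear]
          linear_maps_comp[OF linear_maps_comp[OF A.l_mult_linear P] A.smult_linear]\<close>)
  show ?thesis
    by (intro averaging_algebra.intro averaging_algebra_axioms.intro assms 1 2 3)
qed

text \<open>The whole ring is an operated ideal containing \<open>X\<close>, so the intersection is
  over a nonempty family; an empty one would give the universal set of the type.\<close>

lemma gen_operated_ideal_operated:
  assumes "ring R" "N \<in> carrier R \<rightarrow> carrier R" "X \<subseteq> carrier R"
  shows "operated_ideal (gen_operated_ideal R N X) R N"
proof -
  interpret ring R by fact
  have "operated_ideal (carrier R) R N" using assms oneideal by (auto simp: operated_ideal_def)
  then show ?thesis
    using assms(3) unfolding operated_ideal_def gen_operated_ideal_def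
    by (auto intro!: i_Intersect)
qed

lemma gen_operated_ideal_superset: "X \<subseteq> gen_operated_ideal R N X"
  by (auto simp: gen_operated_ideal_def)

lemma gen_operated_ideal_least:
  "operated_ideal J R N \<Longrightarrow> X \<subseteq> J \<Longrightarrow> gen_operated_ideal R N X \<subseteq> J"
  by (auto simp: gen_operated_ideal_def)

section \<open>Bracketed words\<close>

abbreviation words :: "'x set \<Rightarrow> 'x bword set"
  where "words S \<equiv> carrier (bword_monoid S)"

lemma bword_monoid_mult [simp]: "u \<otimes>\<^bsub>bword_monoid S\<^esub> v = u @ v"
  and bword_monoid_one [simp]: "\<one>\<^bsub>bword_monoid S\<^esub> = []"
  and words_iff: "w \<in> words S \<longleftrightarrow> (\<exists>n. w \<in> bwords n S)"
  by (simp_all add: bword_monoid_def)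

lemma bwords_Suc: "bwords n S \<subseteq> bwords (Suc n) S"
proof (induction n)
  case (Suc n)
  then have "Var ` S \<union> Br ` bwords n S \<subseteq> Var ` S \<union> Br ` bwords (Suc n) S" by blast
  then show ?case unfolding bwords.simps(2)[of "Suc n"] bwords.simps(2)[of n S] by (rule lists_mono)
qed auto

lemma bwords_mono: "m \<le> n \<Longrightarrow> bwords m S \<subseteq> bwords n S"
  by (rule lift_Suc_mono_le[of "\<lambda>n. bwords n S"]) (rule bwords_Suc)

lemma Nil_in_words [simp]: "[] \<in> words S"
  by (auto simp: words_iff intro: exI[of _ 0])

lemma Var_in_words: "x \<in> S \<Longrightarrow> [Var x] \<in> words S"
  by (auto simp: words_iff intro: exI[of _ 0])

lemma bracket_in_words [simp]: "w \<in> words S \<Longrightarrow> bracket w \<in> words S"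
proof -
  assume "w \<in> words S"
  then obtain n where "w \<in> bwords n S" by (auto simp: words_iff)
  then have "bracket w \<in> bwords (Suc n) S" by (simp add: bracket_def)
  then show ?thesis unfolding words_iff by blast
qed

text \<open>Words of different bracket depth are first placed in a common level, and each level is a
  set of lists over some alphabet, hence closed under concatenation.\<close>

lemma append_in_words [simp]: "u \<in> words S \<Longrightarrow> v \<in> words S \<Longrightarrow> u @ v \<in> words S"
proof -
  assume "u \<in> words S" "v \<in> words S"
  then obtain m n where "u \<in> bwords m S" "v \<in> bwords n S" by (auto simp: words_iff)
  then have uv: "u \<in> bwords (max m n) S" "v \<in> bwords (max m n) S"
    using bwords_mono[of m "max m n" S] bwords_mono[of n "max m n" S] by auto
  then have "u @ v \<in> bwords (max m n) S" by (cases "max m n") auto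
  then show ?thesis unfolding words_iff by blast
qed

lemma monoid_bword_monoid: "monoid (bword_monoid S)"
  by (rule monoidI) auto

text \<open>Words are generated from the variables by unit, bracket and product, exactly the
  operations that morphisms respect. The proof nests an induction along the list inside one on the
  bracket depth.\<close>

lemma words_induct [consumes 1, case_names Nil Var bracket append]:
  assumes "w \<in> words S"
    and Nil: "Q []"
    and Var: "\<And>x. x \<in> S \<Longrightarrow> Q [Var x]"
    and bracket: "\<And>w. w \<in> words S \<Longrightarrow> Q w \<Longrightarrow> Q (bracket w)"
    and append: "\<And>u v. u \<in> words S \<Longrightarrow> v \<in> words S \<Longrightarrow> Q u \<Longrightarrow> Q v \<Longrightarrow> Q (u @ v)"
  shows "Q w"
proof -
  \<comment> \<open>The inner induction, for any alphabet \<open>L\<close> of admissible letters.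
    Membership in \<open>words S\<close> is carried along because the \<open>append\<close>
    hypothesis demands it for both factors.\<close>
  have list: "w \<in> words S \<and> Q w"
    if "w \<in> lists L" "\<And>l. l \<in> L \<Longrightarrow> [l] \<in> words S \<and> Q [l]" for w L
    using that(1)
  proof (induction rule: lists.induct)
    case Nil
    show ?case using assms(2) by simp
  next
    case (Cons l w)
    then show ?case using that(2)[of l] append[of "[l]" w] append_in_words[of "[l]" S w] by simp
  qed
  have "w \<in> bwords n S \<Longrightarrow> w \<in> words S \<and> Q w" for n w
  proof (induction n arbitrary: w)
    case 0
    then show ?case by (intro list[of w "Var ` S"]) (auto simp: Var Var_in_words)
  next
    case (Suc n)
    show ?case
    proof (rule list[of w "Var ` S \<union> Br ` bwords n S"])
      show "w \<in> lists (Var ` S \<union> Br ` bwords n S)" using Suc.prems by simp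
      show "[l] \<in> words S \<and> Q [l]" if "l \<in> Var ` S \<union> Br ` bwords n S" for l
        using that Suc.IH bracket bracket_in_words by (auto simp: Var Var_in_words bracket_def)
    qed
  qed
  then show ?thesis using assms(1) by (auto simp: words_iff)
qed

section \<open>Evaluation of bracketed words in a monoid with a self-map\<close>

primrec eval_letter ::
  "('a, 'm) monoid_scheme \<Rightarrow> ('a \<Rightarrow> 'a) \<Rightarrow> ('x \<Rightarrow> 'a) \<Rightarrow> 'x letter \<Rightarrow> 'a" where
  "eval_letter A P f (Var x) = f x"
| "eval_letter A P f (Br w) = P (foldr (\<otimes>\<^bsub>A\<^esub>) (map (eval_letter A P f) w) \<one>\<^bsub>A\<^esub>)"

text \<open>The universal map of the free operated monoid: \<open>P\<close> may be any self-map at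
  this stage. The fold occurs unnamed in \<open>eval_letter\<close>, where the recursion goes
  through \<open>map\<close> on the nested list.\<close>

definition eval_word ::
  "('a, 'm) monoid_scheme \<Rightarrow> ('a \<Rightarrow> 'a) \<Rightarrow> ('x \<Rightarrow> 'a) \<Rightarrow> 'x bword \<Rightarrow> 'a"
  where "eval_word A P f w = foldr (\<otimes>\<^bsub>A\<^esub>) (map (eval_letter A P f) w) \<one>\<^bsub>A\<^esub>"

context
  fixes A :: "('a, 'm) monoid_scheme" and P :: "'a \<Rightarrow> 'a" and f :: "'x \<Rightarrow> 'a" and S :: "'x set"
  assumes A: "monoid A" and P: "P \<in> carrier A \<rightarrow> carrier A" and f: "f \<in> S \<rightarrow> carrier A"
begin

interpretation A: monoid A by (rule A)

lemma eval_word_closed_letters: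
  "set (map (eval_letter A P f) w) \<subseteq> carrier A \<Longrightarrow> eval_word A P f w \<in> carrier A"
  by (induction w) (auto simp: eval_word_def)

lemma eval_word_append_letters:
  assumes "set (map (eval_letter A P f) (u @ v)) \<subseteq> carrier A"
  shows "eval_word A P f (u @ v) = eval_word A P f u \<otimes>\<^bsub>A\<^esub> eval_word A P f v"
  using assms eval_word_closed_letters
  by (induction u) (auto simp: eval_word_def A.m_assoc)

text \<open>Closure is proved letter by letter because multiplicativity of evaluation rests on
  associativity in \<open>A\<close>, available only on the carrier. For concatenation it is then a
  mere union, and a bracket contributes the single value of \<open>P\<close> at an evaluated
  word.\<close>

lemma eval_letter_closed:
  assumes "w \<in> words S" shows "set (map (eval_letter A P f) w) \<subseteq> carrier A"
  using assms
proof (induction rule: words_induct)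
  case (bracket w)
  then have "eval_word A P f w \<in> carrier A" by (intro eval_word_closed_letters)
  then show ?case using P by (auto simp: bracket_def eval_word_def)
qed (use f in auto)

lemma eval_word_closed: "w \<in> words S \<Longrightarrow> eval_word A P f w \<in> carrier A"
  by (intro eval_word_closed_letters eval_letter_closed)

lemma eval_word_Var: "x \<in> S \<Longrightarrow> eval_word A P f [Var x] = f x"
  using funcset_mem[OF f] by (simp add: eval_word_def)

lemma eval_word_bracket:
  "w \<in> words S \<Longrightarrow> eval_word A P f (bracket w) = P (eval_word A P f w)"
  \<comment> \<open>A one-letter word evaluates to its letter times the final unit of the fold;
    closure lets that unit cancel.\<close>
  using funcset_mem[OF P eval_word_closed] by (simp add: eval_word_def bracket_def)

lemma eval_word_hom: "eval_word A P f \<in> hom (bword_monoid S) A"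
proof (rule homI)
  fix u v assume "u \<in> words S" "v \<in> words S"
  then show "eval_word A P f (u \<otimes>\<^bsub>bword_monoid S\<^esub> v) = eval_word A P f u \<otimes>\<^bsub>A\<^esub> eval_word A P f v"
    using eval_letter_closed[of "u @ v"] by (simp add: eval_word_append_letters)
qed (rule eval_word_closed)

end

section \<open>The free averaging algebra\<close>

locale free_averaging_loc = K: cring K
  for K :: "('k, 'n) ring_scheme" and wt :: 'k and S :: "'x set" +
  assumes wt_closed: "wt \<in> carrier K" and wt_nonzero: "wt \<noteq> \<zero>\<^bsub>K\<^esub>"
begin

sublocale monoid_algebra_loc K "bword_monoid S"
  by (intro monoid_algebra_loc.intro K.is_cring monoid_bword_monoid)

abbreviation op where "op \<equiv> linear_extension K bracket"
abbreviation I where "I \<equiv> averaging_ideal K wt S"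

lemma op_linear: "op \<in> linear_maps K KM KM"
  by (rule linear_extension_linear) auto

lemma averaging_relators_eq:
  "averaging_relators K wt S = (\<Union>x\<in>words S. \<Union>y\<in>words S.
     {e (bracket x @ bracket y) \<ominus>\<^bsub>KM\<^esub> e (bracket (bracket x @ y)),
      e (bracket x @ bracket y) \<ominus>\<^bsub>KM\<^esub> e (bracket (x @ bracket y)),
      e (bracket x @ bracket y) \<ominus>\<^bsub>KM\<^esub> wt \<odot>\<^bsub>KM\<^esub> e (bracket (x @ y))})"
  by (simp add: averaging_relators_def Let_def)

sublocale KM: assoc_algebra K KM
  by (rule algebra_assoc_algebra)

lemma averaging_ideal_operated: "operated_ideal I KM op"
  unfolding averaging_ideal_def
proof (rule gen_operated_ideal_operated)
  show "ring KM" by (rule KM.ring_axioms)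
  show "op \<in> carrier KM \<rightarrow> carrier KM" using linear_maps_closed[OF op_linear] by auto
  show "averaging_relators K wt S \<subseteq> carrier KM"
    by (auto simp: averaging_relators_eq basis_closed wt_closed)
qed

sublocale algebra_ideal K KM I
  using averaging_ideal_operated
  by (intro algebra_ideal.intro KM.assoc_algebra_axioms) (simp add: operated_ideal_def)

lemma op_ideal: "a \<in> I \<Longrightarrow> op a \<in> I"
  using averaging_ideal_operated by (simp add: operated_ideal_def)

abbreviation F where "F \<equiv> free_averaging K wt S"
abbreviation FP where "FP \<equiv> free_averaging_op K wt S"
abbreviation \<iota> where "\<iota> \<equiv> free_averaging_incl K wt S"

lemma free_averaging_eq: "F = Q"
  by (simp add: free_averaging_def)

lemma incl_eq: "\<iota> x = proj (e [Var x])"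
  by (simp add: free_averaging_incl_def)

lemma op_proj: "a \<in> carrier KM \<Longrightarrow> FP (proj a) = proj (op a)"
  unfolding free_averaging_op_def by (rule induced_map_proj[OF op_linear op_ideal])

text \<open>The form in which relators are applied: each is a difference, and membership in the
  ideal turns it into an equality of cosets.\<close>

lemma relator_proj:
  assumes "a \<ominus>\<^bsub>KM\<^esub> b \<in> averaging_relators K wt S" "a \<in> carrier KM" "b \<in> carrier KM"
  shows "proj a = proj b"
proof -
  have "a \<ominus>\<^bsub>KM\<^esub> b \<in> I"
    unfolding averaging_ideal_def by (rule subsetD[OF gen_operated_ideal_superset assms(1)])
  then show ?thesis using proj_eq_iff[OF assms(2,3)] by blast
qed

lemma free_spanned: "carrier F \<subseteq> lspan K F (proj ` e ` words S)"
  unfolding free_averaging_eq using algebra_spanned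
  by (intro quotient_spanned) (auto simp: basis_closed)

lemma free_averaging_algebra: "averaging_algebra K F wt FP"
proof (rule averaging_algebraI_lspan[OF _ wt_closed wt_nonzero _ _ free_spanned])
  show "assoc_algebra K F" unfolding free_averaging_eq by (rule quotient_assoc_algebra)
  show "FP \<in> linear_maps K F F"
    unfolding free_averaging_eq free_averaging_op_def
    by (rule induced_map_linear[OF op_linear op_ideal])
  show "proj ` e ` words S \<subseteq> carrier F"
    by (auto simp: free_averaging_eq quotient_carrier basis_closed)
next
  fix a b assume "a \<in> proj ` e ` words S" "b \<in> proj ` e ` words S"
  then obtain x y where xy: "x \<in> words S" "y \<in> words S" "a = proj (e x)" "b = proj (e y)" by auto
  \<comment> \<open>With these rules both sides of each identity become cosets of single words, up
    to the factor \<open>wt\<close>, and the identity is then one of the three relations in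
    \<open>rel\<close>.\<close>
  note simps = free_averaging_eq op_proj quotient_simps linear_extension_basis basis_mult
    basis_closed wt_closed
  have rel: "proj (e (bracket x @ bracket y)) = proj (e (bracket (bracket x @ y)))"
    "proj (e (bracket x @ bracket y)) = proj (e (bracket (x @ bracket y)))"
    "proj (e (bracket x @ bracket y)) = proj (wt \<odot>\<^bsub>KM\<^esub> e (bracket (x @ y)))"
    by (rule relator_proj;
        use xy(1,2) in \<open>auto simp: averaging_relators_eq basis_closed wt_closed\<close>)+
  show "FP a \<otimes>\<^bsub>F\<^esub> FP b = FP (FP a \<otimes>\<^bsub>F\<^esub> b)"
    using xy rel(1) by (simp add: simps)
  show "FP a \<otimes>\<^bsub>F\<^esub> FP b = FP (a \<otimes>\<^bsub>F\<^esub> FP b)"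
    using xy rel(2) by (simp add: simps)
  show "FP a \<otimes>\<^bsub>F\<^esub> FP b = wt \<odot>\<^bsub>F\<^esub> FP (a \<otimes>\<^bsub>F\<^esub> b)"
    using xy rel(3) by (simp add: simps)
qed

text \<open>The last claim is what allows the factorization through the quotient. The kernel of
  \<open>h\<close> is closed under brackets because \<open>h\<close> carries brackets to
  \<open>P\<close> and \<open>P\<close> fixes zero.\<close>

lemma lift_eval_word:
  assumes "averaging_algebra K A wt P" and f: "f \<in> S \<rightarrow> carrier A"
  defines "h \<equiv> lift A (eval_word A P f)"
  shows "h \<in> linear_maps K KM A" "h \<in> ring_hom KM A"
    and "x \<in> S \<Longrightarrow> h (e [Var x]) = f x"
    and "a \<in> carrier KM \<Longrightarrow> h (op a) = P (h a)"
    and "a \<in> I \<Longrightarrow> h a = \<zero>\<^bsub>A\<^esub>"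
proof -
  interpret A: averaging_algebra K A wt P by fact
  have "P \<in> carrier A \<rightarrow> carrier A" using linear_maps_closed[OF A.P_linear] by auto
  note ev = A.monoid_axioms this f
  note ev_simps = eval_word_Var[OF ev] eval_word_bracket[OF ev] eval_word_closed[OF ev]
    hom_mult[OF eval_word_hom[OF ev], simplified]
  have cl: "eval_word A P f \<in> words S \<rightarrow> carrier A" by (auto simp: ev_simps)
  show lin: "h \<in> linear_maps K KM A"
    unfolding h_def by (rule lift_linear[OF A.module_axioms cl])
  have basis: "h (e w) = eval_word A P f w" if "w \<in> words S" for w
    unfolding h_def using that by (rule lift_basis[OF A.module_axioms cl])
  show hom: "h \<in> ring_hom KM A"
    unfolding h_def
    by (rule lift_ring_hom[OF A.assoc_algebra_axioms eval_word_hom[OF ev]]) (simp add: eval_word_def)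
  show "x \<in> S \<Longrightarrow> h (e [Var x]) = f x"
    by (simp add: basis Var_in_words ev_simps)
  \<comment> \<open>Both sides are linear in \<open>a\<close>, and on a word this is the bracket
    rule of \<open>eval_word\<close>.\<close>
  have h_op: "h (op a) = P (h a)" if "a \<in> carrier KM" for a
    by (rule linear_maps_eq_on_lspan[OF KM.module_axioms A.module_axioms
          linear_maps_comp[OF op_linear lin] linear_maps_comp[OF lin A.P_linear], of "e ` words S"])
      (use that algebra_spanned in \<open>auto simp: basis_closed linear_extension_basis basis ev_simps\<close>)
  then show "a \<in> carrier KM \<Longrightarrow> h (op a) = P (h a)" .
  have h: "ring_hom_ring KM A h"
    by (rule ring_hom_ringI2[OF KM.ring_axioms A.ring_axioms hom])
  have "I \<subseteq> a_kernel KM A h"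
    unfolding averaging_ideal_def
  proof (rule gen_operated_ideal_least)
    show "operated_ideal (a_kernel KM A h) KM op"
      unfolding operated_ideal_def using ring_hom_ring.kernel_is_ideal[OF h]
      by (auto simp: a_kernel_def' linear_maps_closed[OF op_linear] h_op
          linear_maps_zero[OF A.module_axioms A.module_axioms A.P_linear])
    \<comment> \<open>The averaging identities of \<open>A\<close>, read from right to left, turn
      the image of every relator into this product minus itself; knowing that the product lies in
      the carrier makes the difference zero.\<close>
    have "P (eval_word A P f x) \<otimes>\<^bsub>A\<^esub> P (eval_word A P f y) \<in> carrier A"
      if "x \<in> words S" "y \<in> words S" for x y
      using that linear_maps_closed[OF A.P_linear] by (simp add: ev_simps)
    then show "averaging_relators K wt S \<subseteq> a_kernel KM A h"
      by (auto simp: averaging_relators_eq a_kernel_def' basis_closed wt_closed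
          linear_maps_minus[OF KM.module_axioms A.module_axioms lin] linear_maps_smult[OF lin]
          basis ev_simps A.P_mult_left[symmetric] A.P_mult_right[symmetric] A.P_mult_wt[symmetric]
          A.minus_eq_zero_iff)
  qed
  then show "a \<in> I \<Longrightarrow> h a = \<zero>\<^bsub>A\<^esub>" by (auto simp: a_kernel_def')
qed

text \<open>The cosets of words span, and \<open>words_induct\<close> treats these: its four cases
  use preservation of the unit, agreement on variables, compatibility with the operators and
  multiplicativity.\<close>

lemma averaging_hom_unique:
  assumes A: "averaging_algebra K A wt P"
    and g: "g \<in> averaging_hom K F FP A P" "g' \<in> averaging_hom K F FP A P"
    and eq: "\<And>x. x \<in> S \<Longrightarrow> g (\<iota> x) = g' (\<iota> x)" and C: "C \<in> carrier F"
  shows "g C = g' C"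
proof -
  interpret A: averaging_algebra K A wt P by fact
  interpret F: averaging_algebra K F wt FP by (rule free_averaging_algebra)
  have lin: "g \<in> linear_maps K F A" "g' \<in> linear_maps K F A"
    and hom: "g \<in> ring_hom F A" "g' \<in> ring_hom F A"
    and op: "\<And>C. C \<in> carrier F \<Longrightarrow> g (FP C) = P (g C)" "\<And>C. C \<in> carrier F \<Longrightarrow> g' (FP C) = P (g' C)"
    using g by (auto simp: averaging_hom_def)
  have cl: "proj (e w) \<in> carrier F" if "w \<in> words S" for w
    using that by (auto simp: free_averaging_eq quotient_carrier basis_closed)
  have words: "g (proj (e w)) = g' (proj (e w))" if "w \<in> words S" for w
    using that
  proof (induction rule: words_induct)
    case Nil
    have "proj (e []) = \<one>\<^bsub>F\<^esub>" by (simp add: free_averaging_eq quotient_one algebra_one)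
    then show ?case using hom by (simp add: ring_hom_one)
  next
    case (Var x)
    then show ?case using eq by (simp add: incl_eq)
  next
    case (bracket w)
    then have "proj (e (bracket w)) = FP (proj (e w))"
      by (simp add: op_proj basis_closed linear_extension_basis)
    then show ?case using bracket op cl by simp
  next
    case (append u v)
    then have "proj (e (u @ v)) = proj (e u) \<otimes>\<^bsub>F\<^esub> proj (e v)"
      by (simp add: free_averaging_eq quotient_mult basis_closed basis_mult)
    then show ?case using append cl ring_hom_mult[OF hom(1)] ring_hom_mult[OF hom(2)] by simp
  qed
  show ?thesis
    by (rule linear_maps_eq_on_lspan[OF F.module_axioms A.module_axioms lin _ subsetD[OF free_spanned C]])
      (use cl words in auto)
qed

lemma free_averaging_universal:
  assumes A: "averaging_algebra K A wt P" and f: "f \<in> S \<rightarrow> carrier A"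
  shows "\<exists>!g. g \<in> averaging_hom K F FP A P \<and> g \<in> extensional (carrier F) \<and> (\<forall>x\<in>S. g (\<iota> x) = f x)"
proof -
  interpret A: averaging_algebra K A wt P by fact
  note h = lift_eval_word[OF A f]
  obtain g where g: "g \<in> ring_hom Q A" "g \<in> linear_maps K Q A" "g \<in> extensional (carrier Q)"
    "\<And>a. a \<in> carrier KM \<Longrightarrow> g (proj a) = lift A (eval_word A P f) a"
    using quotient_factor[OF A.assoc_algebra_axioms h(1,2,5)] by metis
  \<comment> \<open>On the coset of \<open>a\<close> this is the commutation of the lift with
    brackets, pushed through \<open>proj\<close>.\<close>
  have "\<forall>C\<in>carrier F. P (g C) = g (FP C)"
    by (auto simp: free_averaging_eq quotient_carrier op_proj g(4) h(4) linear_maps_closed[OF op_linear])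
  then have "g \<in> averaging_hom K F FP A P"
    using g by (simp add: averaging_hom_def free_averaging_eq)
  moreover have "g (\<iota> x) = f x" if "x \<in> S" for x
    using that by (simp add: incl_eq g(4) basis_closed Var_in_words h(3))
  ultimately show ?thesis
    \<comment> \<open>Two candidates agree on the carrier; extensionality makes them equal as
      functions.\<close>
    using g(3) averaging_hom_unique[OF A]
    by (intro ex1I[of _ g]) (auto simp: free_averaging_eq intro!: extensionalityI[of _ "carrier Q"])
qed

text \<open>
  The zero operator makes the word algebra itself an averaging algebra, in which distinct variables
  are distinct.
\<close>

lemma incl_inj:
  assumes "\<one>\<^bsub>K\<^esub> \<noteq> \<zero>\<^bsub>K\<^esub>"
  shows "inj_on \<iota> S"
proof (rule inj_onI)
  have "averaging_algebra K KM wt (\<lambda>_. \<zero>\<^bsub>KM\<^esub>)"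
    by (intro averaging_algebra.intro averaging_algebra_axioms.intro KM.assoc_algebra_axioms
        wt_closed wt_nonzero linear_mapsI) (auto simp: wt_closed)
  then obtain g where g: "\<And>x. x \<in> S \<Longrightarrow> g (\<iota> x) = e [Var x]"
    using free_averaging_universal[of KM "\<lambda>_. \<zero>\<^bsub>KM\<^esub>" "\<lambda>x. e [Var x]"]
    by (auto simp: basis_closed Var_in_words Pi_iff)
  fix x y assume "x \<in> S" "y \<in> S" "\<iota> x = \<iota> y"
  \<comment> \<open>Comparison of the coefficients at the word \<open>[Var x]\<close>: one on the
    left, and zero on the right unless the two variables coincide.\<close>
  then have "e [Var x] [Var x] = e [Var y] [Var x]" using g by metis
  then show "x = y" using assms by (auto simp: basis_elem_def split: if_splits)
qed

end

text \<open>The \<open>inj_on\<close> conjunct renders the word "inclusion" for i, and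
  \<open>extensional\<close> identifies a map on the carrier with a single total function, so that
  uniqueness can be stated by \<open>\<exists>!\<close>.\<close>

theorem mainTheorem1:
  fixes K :: "('k, 'n) ring_scheme" and wt :: 'k and S :: "'x set"
  assumes "field K"
    and "\<And>n::nat. n > 0 \<Longrightarrow> add_pow K n \<one>\<^bsub>K\<^esub> \<noteq> \<zero>\<^bsub>K\<^esub>"
    and "wt \<in> carrier K" and "wt \<noteq> \<zero>\<^bsub>K\<^esub>"
    and "S \<noteq> {}"
  shows "averaging_algebra K (free_averaging K wt S) wt (free_averaging_op K wt S) \<and>
    inj_on (free_averaging_incl K wt S) S \<and>
    (\<forall>(A :: ('k, 'a) module) P f. averaging_algebra K A wt P \<longrightarrow> f \<in> S \<rightarrow> carrier A \<longrightarrow>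
      (\<exists>!g. g \<in> averaging_hom K (free_averaging K wt S) (free_averaging_op K wt S) A P \<and>
            g \<in> extensional (carrier (free_averaging K wt S)) \<and>
            (\<forall>x\<in>S. g (free_averaging_incl K wt S x) = f x)))"
proof -
  interpret K: field K by fact
  interpret free_averaging_loc K wt S
    by (intro free_averaging_loc.intro free_averaging_loc_axioms.intro K.is_cring assms)
  show ?thesis
    using free_averaging_algebra incl_inj[OF K.one_not_zero] free_averaging_universal by blast
qed

end
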